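(* Let $\alpha\in\mathbb{T}$ be irrational with sequence of continued fraction denominators $(q_n)_{n\ge 0}$. Suppose that there exist $\gamma\geq 1$ and $C>0$ such that $q_{n+1}\leq Cq_n^\gamma$ for infinitely many $n\in\mathbb{N}$. Then there exists a continuous function $\varphi:\mathbb{T}\to\mathbb{R}$ with zero mean ($\int_{\mathbb{T}}\varphi\,dx=0$) such that $\dim_H D^{s_-s_+}(\alpha,\varphi)\geq 1/(1+\gamma)$ for all $s_-,s_+\in\{+,-\}$.
   Context: $\mathbb{T}=\mathbb{R}/\mathbb{Z}$, identified with $[0,1)$; $\dim_H$ is Hausdorff dimension. If $\alpha=[0;a_1,a_2,\ldots]$ is the continued fraction expansion, then $q_{-1}=0$, $q_0=1$, $q_n=a_nq_{n-1}+q_{n-2}$ for $n\ge1$. For $n\in\mathbb{Z}$: $\varphi^{(n)}(x)=\sum_{k=0}^{n-1}\varphi(x+k\alpha)$ for $n>0$, $\varphi^{(0)}=0$, $\varphi^{(n)}(x)=-\sum_{k=1}^{|n|}\varphi(x-k\alpha)$ for $n<0$. For $s_-,s_+\in\{-,+\}$, $D^{s_-s_+}(\alpha,\varphi)=\{x\in\mathbb{T}:\ \varphi^{(m)}(x)\to s_-\infty \text{ as } m\to-\infty \text{ and } \varphi^{(m)}(x)\to s_+\infty\text{ as }m\to+\infty\}$. *)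

theory Defs
  imports "HOL-Analysis.Analysis"
begin

section \<open>Hausdorff dimension\<close>

text \<open>
  The gauge \<open>(diam U)\<^sup>s\<close>, with the usual conventions that the empty set contributes
  \<open>0\<close> and that \<open>0\<^sup>0 = 1\<close> for nonempty sets (whereas \<open>0 powr 0 = 0\<close> in the library).
\<close>
definition diam_gauge :: "real \<Rightarrow> 'a::metric_space set \<Rightarrow> ennreal" where
  "diam_gauge s U =
     (if U = {} then 0 else if s = 0 then 1 else ennreal (diameter U powr s))"

text \<open>
  Boundedness is required explicitly because \<open>diameter\<close> is real-valued and
  unspecified on unbounded sets.
\<close>
definition delta_covers :: "real \<Rightarrow> 'a::metric_space set \<Rightarrow> (nat \<Rightarrow> 'a set) set" where
  "delta_covers \<delta> A =
     {U. A \<subseteq> (\<Union>i. U i) \<and> (\<forall>i. bounded (U i) \<and> diameter (U i) \<le> \<delta>)}"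

definition hausdorff_premeasure :: "real \<Rightarrow> real \<Rightarrow> 'a::metric_space set \<Rightarrow> ennreal" where
  "hausdorff_premeasure s \<delta> A = (INF U \<in> delta_covers \<delta> A. \<Sum>i. diam_gauge s (U i))"

definition hausdorff_measure :: "real \<Rightarrow> 'a::metric_space set \<Rightarrow> ennreal" where
  "hausdorff_measure s A = (SUP \<delta> \<in> {0<..}. hausdorff_premeasure s \<delta> A)"

definition hausdorff_dim :: "'a::metric_space set \<Rightarrow> ereal" where
  "hausdorff_dim A = (INF s \<in> {s. 0 \<le> s \<and> hausdorff_measure s A = 0}. ereal s)"


section \<open>Continued fraction expansion\<close>

text \<open>
  For irrational \<open>\<alpha>\<close>, \<open>\<alpha> = [a\<^sub>0; a\<^sub>1, \<dots>, a\<^bsub>n-1\<^esub>, \<xi>\<^sub>n]\<close> with complete quotients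
  \<open>\<xi>\<^sub>0 = \<alpha>\<close>, \<open>\<xi>\<^bsub>n+1\<^esub> = 1 / frac \<xi>\<^sub>n\<close> and partial quotients \<open>a\<^sub>n = \<lfloor>\<xi>\<^sub>n\<rfloor>\<close>;
  \<open>a\<^sub>0 = 0\<close> when \<open>\<alpha> \<in> [0,1)\<close>.
\<close>
primrec cf_quotient :: "real \<Rightarrow> nat \<Rightarrow> real" where
  "cf_quotient \<alpha> 0 = \<alpha>"
| "cf_quotient \<alpha> (Suc n) = 1 / frac (cf_quotient \<alpha> n)"

definition cf_coeff :: "real \<Rightarrow> nat \<Rightarrow> int" where
  "cf_coeff \<alpha> n = \<lfloor>cf_quotient \<alpha> n\<rfloor>"

text \<open>The second equation is \<open>q\<^sub>1 = a\<^sub>1 q\<^sub>0 + q\<^bsub>-1\<^esub>\<close> with \<open>q\<^sub>0 = 1\<close> and \<open>q\<^bsub>-1\<^esub> = 0\<close>.\<close>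
fun cf_denom :: "real \<Rightarrow> nat \<Rightarrow> int" where
  "cf_denom \<alpha> 0 = 1"
| "cf_denom \<alpha> (Suc 0) = cf_coeff \<alpha> 1"
| "cf_denom \<alpha> (Suc (Suc n)) =
     cf_coeff \<alpha> (Suc (Suc n)) * cf_denom \<alpha> (Suc n) + cf_denom \<alpha> n"


section \<open>Birkhoff sums over a rotation\<close>

text \<open>
  Functions on \<open>\<real>/\<int>\<close> are represented by 1-periodic functions on \<open>\<real>\<close>, and points of
  \<open>\<real>/\<int>\<close> by their representatives in \<open>[0,1)\<close>. Continuity on \<open>\<real>/\<int>\<close> is continuity of the
  periodic lift on all of \<open>\<real>\<close>.
\<close>
definition continuous_on_circle :: "(real \<Rightarrow> real) \<Rightarrow> bool" where
  "continuous_on_circle \<phi> \<longleftrightarrow> continuous_on UNIV \<phi> \<and> (\<forall>x. \<phi> (x + 1) = \<phi> x)"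

definition birkhoff_sum :: "real \<Rightarrow> (real \<Rightarrow> real) \<Rightarrow> int \<Rightarrow> real \<Rightarrow> real" where
  "birkhoff_sum \<alpha> \<phi> n x =
     (if n \<ge> 0 then (\<Sum>k<nat n. \<phi> (x + real k * \<alpha>))
      else - (\<Sum>k=1..nat \<bar>n\<bar>. \<phi> (x - real k * \<alpha>)))"

datatype sign = Minus | Plus

primrec signed_infinity :: "sign \<Rightarrow> real filter" where
  "signed_infinity Minus = at_bot"
| "signed_infinity Plus = at_top"

definition discrete_orbit_set :: "sign \<Rightarrow> sign \<Rightarrow> real \<Rightarrow> (real \<Rightarrow> real) \<Rightarrow> real set" where
  "discrete_orbit_set s t \<alpha> \<phi> =
     {x \<in> {0..<1}.
        filterlim (\<lambda>m. birkhoff_sum \<alpha> \<phi> m x) (signed_infinity s) at_bot \<and>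
        filterlim (\<lambda>m. birkhoff_sum \<alpha> \<phi> m x) (signed_infinity t) at_top}"

end

theory Submission
  imports Defs
begin

text \<open>
  Choose sparse integers \<open>Q\<^sub>k\<close> (denominators up to sign) with \<open>\<delta>\<^sub>k = Q\<^sub>k \<alpha> - p\<^sub>k\<close> positive and at
  least a constant times \<open>\<bar>Q\<^sub>k\<bar>\<^sup>-\<^sup>\<gamma>\<close>. The cocycle is a uniformly convergent sum of coboundaries of
  \<open>W\<^sub>k (Q\<^sub>k x)\<close>, where \<open>W\<^sub>k\<close> is a 1-periodic wave with a small multiple of \<open>1 / \<delta>\<^sub>k\<close> as slope, so
  that its \<open>m\<close>-th Birkhoff sum is \<open>\<Sum>\<^sub>k W\<^sub>k (Q\<^sub>k x + m \<delta>\<^sub>k) - W\<^sub>k (Q\<^sub>k x)\<close>. The wave has a minimum at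
  \<open>0\<close>, a maximum at \<open>1/2\<close>, a steep ascent at \<open>1/4\<close> and a steep descent at \<open>3/4\<close>; if \<open>Q\<^sub>k x\<close> lies
  within \<open>\<delta>\<^sub>k\<close> of one of these centres for every \<open>k\<close>, the Birkhoff sums at \<open>x\<close> diverge with the
  corresponding pair of signs. These \<open>x\<close> form a Cantor set which at stage \<open>k\<close> consists of intervals
  of length \<open>\<delta>\<^sub>k / \<bar>Q\<^sub>k\<bar>\<close>, at least of order \<open>\<bar>Q\<^sub>k\<bar>\<^sup>-\<^sup>1\<^sup>-\<^sup>\<gamma>\<close>, with spacing \<open>1 / \<bar>Q\<^sub>k\<bar>\<close>, and
  hence has dimension at least \<open>1 / (1 + \<gamma>)\<close>.
\<close>

section \<open>Continued fraction remainders\<close>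

declare cf_quotient.simps(2) [simp del]

text \<open>Irrationality passes through fractional parts and reciprocals, so no fractional part
  vanishes and the recursion never meets the default value \<open>1 / 0 = 0\<close>.\<close>

lemma cf_quotient_irrational:
  assumes "\<alpha> \<notin> \<rat>"
  shows "cf_quotient \<alpha> n \<notin> \<rat>"
proof (induction n)
  case (Suc n)
  show ?case
  proof
    assume "cf_quotient \<alpha> (Suc n) \<in> \<rat>"
    then have "inverse (inverse (frac (cf_quotient \<alpha> n))) \<in> \<rat>"
      by (metis Rats_inverse cf_quotient.simps(2) inverse_eq_divide)
    then have "frac (cf_quotient \<alpha> n) + of_int \<lfloor>cf_quotient \<alpha> n\<rfloor> \<in> \<rat>"
      by (intro Rats_add) simp_all
    with Suc show False
      by (simp add: frac_def)
  qed
qed (use assms in simp)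

lemma frac_cf_quotient_pos:
  assumes "\<alpha> \<notin> \<rat>"
  shows "0 < frac (cf_quotient \<alpha> n)"
proof -
  have "cf_quotient \<alpha> n \<notin> \<int>"
    using cf_quotient_irrational[OF assms] Ints_subset_Rats by blast
  then show ?thesis
    by (simp add: frac_gt_0_iff)
qed

lemma cf_quotient_Suc_gt_1:
  assumes "\<alpha> \<notin> \<rat>"
  shows "1 < cf_quotient \<alpha> (Suc n)"
  using frac_cf_quotient_pos[OF assms, of n] frac_lt_1[of "cf_quotient \<alpha> n"]
  by (simp add: cf_quotient.simps)

lemma cf_quotient_eq:
  "cf_quotient \<alpha> n = of_int (cf_coeff \<alpha> n) + 1 / cf_quotient \<alpha> (Suc n)"
  by (simp add: cf_coeff_def frac_def cf_quotient.simps)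

lemma cf_coeff_Suc_ge_1:
  assumes "\<alpha> \<notin> \<rat>"
  shows "1 \<le> cf_coeff \<alpha> (Suc n)"
  using cf_quotient_Suc_gt_1[OF assms, of n] by (simp add: cf_coeff_def)

lemma cf_denom_ge:
  assumes "\<alpha> \<notin> \<rat>"
  shows "1 \<le> cf_denom \<alpha> n \<and> int n \<le> cf_denom \<alpha> n"
proof (induction n rule: induct_nat_012)
  case (ge2 n)
  have "1 * cf_denom \<alpha> (Suc n) \<le> cf_coeff \<alpha> (Suc (Suc n)) * cf_denom \<alpha> (Suc n)"
    using cf_coeff_Suc_ge_1[OF assms] ge2 by (intro mult_right_mono) auto
  then show ?case
    unfolding cf_denom.simps using ge2 by (intro conjI; linarith)
qed (use cf_coeff_Suc_ge_1[OF assms, of 0] in auto)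

lemma cf_denom_mono:
  assumes "\<alpha> \<notin> \<rat>"
  shows "cf_denom \<alpha> n \<le> cf_denom \<alpha> (Suc n)"
proof (cases n)
  case (Suc k)
  have "1 * cf_denom \<alpha> (Suc k) \<le> cf_coeff \<alpha> (Suc (Suc k)) * cf_denom \<alpha> (Suc k)"
    using cf_coeff_Suc_ge_1[OF assms] cf_denom_ge[OF assms, of "Suc k"]
    by (intro mult_right_mono) auto
  then show ?thesis
    using Suc cf_denom_ge[OF assms, of k] by simp
qed (use cf_coeff_Suc_ge_1[OF assms, of 0] in simp)

text \<open>Inserting \<open>\<xi> = a + 1 / \<xi>'\<close> for the last complete quotient and
  multiplying by \<open>\<xi>'\<close> reproduces the recursion of the denominators.\<close>

lemma prod_cf_quotient:
  assumes "\<alpha> \<notin> \<rat>"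
  shows "(\<Prod>i\<le>Suc n. cf_quotient \<alpha> (Suc i)) =
    of_int (cf_denom \<alpha> (Suc n)) * cf_quotient \<alpha> (Suc (Suc n)) + of_int (cf_denom \<alpha> n)"
proof (induction n)
  case 0
  show ?case
    using cf_quotient_Suc_gt_1[OF assms, of 1] cf_quotient_eq[of \<alpha> 1]
    by (simp add: field_simps)
next
  case (Suc n)
  have pos: "0 < cf_quotient \<alpha> (Suc (Suc (Suc n)))"
    using cf_quotient_Suc_gt_1[OF assms, of "Suc (Suc n)"] by linarith
  show ?case
    unfolding prod.atMost_Suc[of _ "Suc n"] Suc.IH
    using pos
    by (subst cf_quotient_eq[of \<alpha> "Suc (Suc n)"])
      (simp add: field_simps)
qed

text \<open>The remainders and the signed reciprocal products obey the same three-term recursion.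
  Only the class modulo 1 matters later, so the numerator is left existential.\<close>

lemma cf_remainder:
  assumes "\<alpha> \<in> {0..<1}" "\<alpha> \<notin> \<rat>"
  shows "\<exists>p::int. of_int (cf_denom \<alpha> n) * \<alpha> - of_int p =
    (- 1) ^ n / (\<Prod>i\<le>n. cf_quotient \<alpha> (Suc i))"
proof (induction n rule: induct_nat_012)
  case 0
  have "frac \<alpha> = \<alpha>"
    using assms by (simp add: frac_eq)
  then show ?case
    by (intro exI[of _ 0]) (simp add: cf_quotient.simps)
next
  case 1
  have eq: "1 / \<alpha> = of_int (cf_coeff \<alpha> 1) + 1 / cf_quotient \<alpha> (Suc 1)"
    using cf_quotient_eq[of \<alpha> 1] assms by (simp add: frac_eq cf_quotient.simps)
  have "0 < \<alpha>" "0 < cf_quotient \<alpha> (Suc 1)"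
    using assms cf_quotient_Suc_gt_1[OF assms(2), of 1] by (auto simp: less_le)
  then have "of_int (cf_coeff \<alpha> 1) * \<alpha> - 1 = - 1 / (1 / \<alpha> * cf_quotient \<alpha> (Suc 1))"
    using eq by (simp add: field_simps)
  moreover have "cf_quotient \<alpha> (Suc 0) = 1 / \<alpha>"
    using assms by (simp add: frac_eq cf_quotient.simps)
  ultimately show ?case
    by (intro exI[of _ 1]) simp
next
  case (ge2 n)
  let ?D = "\<lambda>n. \<Prod>i\<le>n. cf_quotient \<alpha> (Suc i)"
  obtain p p' :: int where p:
    "of_int (cf_denom \<alpha> (Suc n)) * \<alpha> - of_int p = (- 1) ^ Suc n / ?D (Suc n)"
    "of_int (cf_denom \<alpha> n) * \<alpha> - of_int p' = (- 1) ^ n / ?D n"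
    using ge2 by blast
  have pos: "0 < cf_quotient \<alpha> (Suc i)" for i
    using cf_quotient_Suc_gt_1[OF assms(2), of i] by linarith
  have Dpos: "0 < ?D n" for n
    using pos by (intro prod_pos) auto
  let ?x = "cf_quotient \<alpha> (Suc (Suc n))"
  let ?y = "cf_quotient \<alpha> (Suc (Suc (Suc n)))"
  let ?a = "cf_coeff \<alpha> (Suc (Suc n))"
  have x: "?x - of_int ?a = 1 / ?y"
    using cf_quotient_eq[of \<alpha> "Suc (Suc n)"] by simp
  have D1: "?D (Suc n) = ?D n * ?x" and D2: "?D (Suc (Suc n)) = ?D (Suc n) * ?y"
    by (simp_all)
  have "of_int (cf_denom \<alpha> (Suc (Suc n))) * \<alpha> - of_int (?a * p + p') =
      of_int ?a * (of_int (cf_denom \<alpha> (Suc n)) * \<alpha> - of_int p)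
        + (of_int (cf_denom \<alpha> n) * \<alpha> - of_int p')"
    by (simp add: algebra_simps)
  also have "\<dots> = (- 1) ^ n * (1 / ?D n - of_int ?a / ?D (Suc n))"
    unfolding p by (simp add: algebra_simps)
  also have "1 / ?D n - of_int ?a / ?D (Suc n) = (?x - of_int ?a) / ?D (Suc n)"
    using pos[of "Suc n"] unfolding D1 diff_divide_distrib by simp
  also have "\<dots> = 1 / ?D (Suc (Suc n))"
    unfolding x D2 by simp
  finally show ?case
    by (intro exI[of _ "?a * p + p'"]) simp
qed

lemma cf_remainder_bounds:
  assumes "\<alpha> \<in> {0..<1}" "\<alpha> \<notin> \<rat>"
  obtains p :: int where
    "1 / (2 * of_int (cf_denom \<alpha> (Suc n))) \<le> \<bar>of_int (cf_denom \<alpha> n) * \<alpha> - of_int p\<bar>"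
    "\<bar>of_int (cf_denom \<alpha> n) * \<alpha> - of_int p\<bar> \<le> 1 / of_int (cf_denom \<alpha> (Suc n))"
proof -
  let ?D = "\<lambda>n. \<Prod>i\<le>n. cf_quotient \<alpha> (Suc i)"
  let ?q = "\<lambda>n. real_of_int (cf_denom \<alpha> n)"
  have q: "1 \<le> ?q n" for n
    using cf_denom_ge[OF assms(2), of n] by simp
  \<comment> \<open>For \<open>n > 0\<close> the product is \<open>q(n) * \<xi> + q(n-1)\<close>,
    and \<open>q(n+1)\<close> is the same expression with the integer part of \<open>\<xi>\<close>;
    the two differ by at most \<open>q(n)\<close>, hence by at most \<open>q(n+1)\<close>.\<close>
  have D: "?q (Suc n) \<le> ?D n \<and> ?D n \<le> 2 * ?q (Suc n)"
  proof (cases n)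
    case 0
    have "cf_quotient \<alpha> 1 - 1 < of_int (cf_coeff \<alpha> 1)" "of_int (cf_coeff \<alpha> 1) \<le> cf_quotient \<alpha> 1"
      unfolding cf_coeff_def by linarith+
    then show ?thesis
      using 0 q[of 1] by simp
  next
    case (Suc k)
    let ?x = "cf_quotient \<alpha> (Suc (Suc k))"
    let ?a = "real_of_int (cf_coeff \<alpha> (Suc (Suc k)))"
    have "?x - 1 \<le> ?a" "?a \<le> ?x"
      unfolding cf_coeff_def by linarith+
    then have "?q (Suc k) * ?a \<le> ?q (Suc k) * ?x" "?q (Suc k) * ?x \<le> ?q (Suc k) * (?a + 1)"
      using q[of "Suc k"] by (auto intro!: mult_left_mono)
    moreover have "?D n = ?q (Suc k) * ?x + ?q k"
      using prod_cf_quotient[OF assms(2), of k] Suc by simp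
    moreover have "?q (Suc n) = ?q (Suc k) * ?a + ?q k"
      using Suc by simp
    moreover have "?q (Suc k) \<le> ?q (Suc n)"
      unfolding of_int_le_iff using cf_denom_mono[OF assms(2), of n] Suc by simp
    ultimately show ?thesis
      by (simp add: algebra_simps del: cf_denom.simps)
  qed
  obtain p :: int where "?q n * \<alpha> - of_int p = (- 1) ^ n / ?D n"
    using cf_remainder[OF assms] by blast
  then have "\<bar>?q n * \<alpha> - of_int p\<bar> = 1 / ?D n"
    using D q[of "Suc n"] by (simp add: abs_divide power_abs del: cf_denom.simps)
  with D q[of "Suc n"] that[of p] show ?thesis
    by (simp add: frac_le del: cf_denom.simps)
qed

text \<open>Infinitely many admissible \<open>n\<close> allow one with \<open>q(n) >= R\<close>;
  there the general lower bound \<open>1 / (2 * q(n+1))\<close> for the remainder is at least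
  \<open>1 / (2 * C)\<close> times \<open>q(n) powr (- \<gamma>)\<close>.\<close>

lemma ex_approximation_above:
  fixes \<alpha> \<gamma> C :: real
  assumes \<alpha>: "\<alpha> \<in> {0..<1}" "\<alpha> \<notin> \<rat>" and "C > 0"
    and inf: "infinite {n. real_of_int (cf_denom \<alpha> (n + 1)) \<le> C * real_of_int (cf_denom \<alpha> n) powr \<gamma>}"
    and "0 < R"
  shows "\<exists>(Q::int) (p::int). R \<le> \<bar>of_int Q\<bar> \<and> 0 < of_int Q * \<alpha> - of_int p \<and>
    of_int Q * \<alpha> - of_int p \<le> 1 / R \<and>
    1 / (2 * C) * \<bar>of_int Q\<bar> powr (- \<gamma>) \<le> of_int Q * \<alpha> - of_int p"
proof -
  let ?q = "\<lambda>n. real_of_int (cf_denom \<alpha> n)"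
  obtain n where n: "nat \<lceil>R\<rceil> < n" "?q (Suc n) \<le> C * ?q n powr \<gamma>"
    using inf unfolding infinite_nat_iff_unbounded mem_Collect_eq Suc_eq_plus1 by blast
  have q: "1 \<le> ?q m" "real m \<le> ?q m" for m
    using cf_denom_ge[OF \<alpha>(2), of m] by linarith+
  have "R \<le> real n"
    using n by linarith
  then have R: "R \<le> ?q n" "R \<le> ?q (Suc n)"
    using q(2)[of n] q(2)[of "Suc n"] by linarith+
  obtain p :: int where p: "1 / (2 * ?q (Suc n)) \<le> \<bar>?q n * \<alpha> - of_int p\<bar>"
    "\<bar>?q n * \<alpha> - of_int p\<bar> \<le> 1 / ?q (Suc n)"
    using cf_remainder_bounds[OF \<alpha>] .
  \<comment> \<open>The remainders alternate in sign. Negating denominator and numerator together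
    makes the remainder positive, at the price of a possibly negative \<open>Q\<close>.\<close>
  define e :: int where "e = (if ?q n * \<alpha> - of_int p > 0 then 1 else - 1)"
  have e: "of_int (e * cf_denom \<alpha> n) * \<alpha> - of_int (e * p) = \<bar>?q n * \<alpha> - of_int p\<bar>"
    by (auto simp: e_def)
  have abs: "\<bar>of_int (e * cf_denom \<alpha> n)\<bar> = ?q n"
    using q(1)[of n] by (auto simp: e_def)
  have "1 / (2 * C) * ?q n powr (- \<gamma>) = 1 / (2 * (C * ?q n powr \<gamma>))"
    by (simp add: powr_minus divide_simps)
  also have "\<dots> \<le> 1 / (2 * ?q (Suc n))"
    using n q(1)[of "Suc n"] \<open>C > 0\<close> q(1)[of n]
    by (intro divide_left_mono mult_pos_pos mult_left_mono) auto
  finally have "1 / (2 * C) * ?q n powr (- \<gamma>) \<le> \<bar>?q n * \<alpha> - of_int p\<bar>"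
    using p by linarith
  moreover have "1 / ?q (Suc n) \<le> 1 / R"
    using R \<open>0 < R\<close> by (intro divide_left_mono) auto
  moreover have "0 < 1 / (2 * ?q (Suc n))"
    using q(1)[of "Suc n"] by simp
  ultimately show ?thesis
    using R p by (intro exI[of _ "e * cf_denom \<alpha> n"] exI[of _ "e * p"]) (unfold e abs, linarith)
qed

section \<open>Equidistribution of combs\<close>

definition comb :: "real \<Rightarrow> real \<Rightarrow> real \<Rightarrow> real set" where
  "comb Q c \<rho> = {x. frac (Q * x - c) \<le> \<rho>}"

lemma frac_le_iff:
  fixes z r :: real
  assumes "0 \<le> r" "r < 1"
  shows "frac z \<le> r \<longleftrightarrow> (\<exists>n::int. of_int n \<le> z \<and> z \<le> of_int n + r)"
proof
  assume "frac z \<le> r"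
  then show "\<exists>n::int. of_int n \<le> z \<and> z \<le> of_int n + r"
    by (intro exI[of _ "\<lfloor>z\<rfloor>"]) (simp add: frac_def)
next
  assume "\<exists>n::int. of_int n \<le> z \<and> z \<le> of_int n + r"
  then obtain n :: int where n: "of_int n \<le> z" "z \<le> of_int n + r"
    by blast
  then have "\<lfloor>z\<rfloor> = n"
    using assms by (simp add: floor_eq_iff)
  with n show "frac z \<le> r"
    by (simp add: frac_def)
qed

lemma comb_eq_UN:
  assumes "0 < Q" "0 \<le> \<rho>" "\<rho> < 1"
  shows "comb Q c \<rho> = (\<Union>n::int. {(of_int n + c) / Q..(of_int n + c + \<rho>) / Q})"
  using assms by (auto simp: comb_def frac_le_iff field_simps)

text \<open>Reflection makes the teeth extend to the left of their base points; moving the base by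
  \<open>\<rho>\<close> restores the orientation. This reduces negative frequencies to positive
  ones.\<close>

lemma comb_uminus:
  assumes "0 \<le> \<rho>" "\<rho> < 1"
  shows "comb (- Q) c \<rho> = comb Q (- c - \<rho>) \<rho>"
proof -
  have "frac (- z) \<le> \<rho> \<longleftrightarrow> frac (z + \<rho>) \<le> \<rho>" for z
  proof -
    have "(\<exists>n::int. of_int n \<le> - z \<and> - z \<le> of_int n + \<rho>) \<longleftrightarrow>
        (\<exists>n::int. of_int (- n) \<le> - z \<and> - z \<le> of_int (- n) + \<rho>)"
      by (metis minus_minus)
    then show ?thesis
      unfolding frac_le_iff[OF assms] by (auto simp: algebra_simps)
  qed
  moreover have "- Q * x - c = - (Q * x + c)" "Q * x - (- c - \<rho>) = Q * x + c + \<rho>" for x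
    by simp_all
  ultimately show ?thesis
    by (simp only: comb_def)
qed

definition block :: "real \<Rightarrow> real \<Rightarrow> real \<Rightarrow> int \<Rightarrow> real set" where
  "block Q c \<rho> n = {(of_int n + c) / Q..(of_int n + c + \<rho>) / Q}"

lemma block_fmeasurable [simp]: "block Q c \<rho> n \<in> fmeasurable lborel"
  unfolding block_def by (intro fmeasurable_compact) simp

lemma measure_block:
  assumes "0 < Q" "0 \<le> \<rho>"
  shows "measure lborel (block Q c \<rho> n) = \<rho> / Q"
  using assms by (simp add: block_def divide_right_mono diff_divide_distrib[symmetric])


lemma disjoint_block:
  assumes "0 < Q" "\<rho> < 1" "m \<noteq> n"
  shows "disjnt (block Q c \<rho> m) (block Q c \<rho> n)"
proof -
  have *: "m = n" if "of_int m \<le> z" "z \<le> of_int m + \<rho>" "of_int n \<le> z" "z \<le> of_int n + \<rho>" for z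
    using that assms(2) by linarith
  show ?thesis
    unfolding disjnt_iff
  proof (intro allI notI)
    fix x assume "x \<in> block Q c \<rho> m \<and> x \<in> block Q c \<rho> n"
    then have "m = n"
      using assms(1) by (intro *[of "Q * x - c"]) (auto simp: block_def field_simps)
    with assms(3) show False ..
  qed
qed

text \<open>Teeth with other indices miss \<open>{u..v}\<close>. The finite index range is what
  gives compactness, additivity of measure and a count of teeth.\<close>

lemma Int_comb_eq:
  assumes "0 < Q" "0 \<le> \<rho>" "\<rho> < 1" "A \<subseteq> {u..v}"
  shows "A \<inter> comb Q c \<rho> = (\<Union>n\<in>{\<lceil>Q * u - c - \<rho>\<rceil>..\<lfloor>Q * v - c\<rfloor>}. A \<inter> block Q c \<rho> n)"
proof -
  have "n \<in> {\<lceil>Q * u - c - \<rho>\<rceil>..\<lfloor>Q * v - c\<rfloor>}" if "x \<in> A" "x \<in> block Q c \<rho> n" for x n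
  proof -
    have "u \<le> x" "x \<le> v" "of_int n \<le> Q * x - c" "Q * x - c \<le> of_int n + \<rho>"
      using that assms by (auto simp: block_def field_simps)
    moreover from this have "Q * u \<le> Q * x" "Q * x \<le> Q * v"
      using assms(1) by (auto intro: mult_left_mono)
    ultimately show ?thesis
      by (auto simp: ceiling_le_iff le_floor_iff)
  qed
  then show ?thesis
    unfolding comb_eq_UN[OF assms(1-3)] block_def[symmetric] by blast
qed

lemma measure_Icc_Int_comb:
  assumes "0 < Q" "0 < \<rho>" "\<rho> < 1"
  shows "\<bar>measure lborel ({u..v} \<inter> comb Q c \<rho>) - \<rho> * measure lborel {u..v}\<bar> \<le> 2 * \<rho> / Q"
proof (cases "u \<le> v")
  case True
  \<comment> \<open>\<open>I\<close> contains the index of every tooth meeting the interval,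
    \<open>J\<close> only indices of teeth inside it. The first count exceeds
    \<open>Q * (v - u)\<close> by at most 2, the second falls short of it by at most 2.\<close>
  define I where "I = {\<lceil>Q * u - c - \<rho>\<rceil>..\<lfloor>Q * v - c\<rfloor>}"
  define J where "J = {\<lceil>Q * u - c\<rceil>..\<lfloor>Q * v - c - \<rho>\<rfloor>}"
  have eq: "{u..v} \<inter> comb Q c \<rho> = (\<Union>n\<in>I. {u..v} \<inter> block Q c \<rho> n)"
    unfolding I_def using assms by (intro Int_comb_eq) auto
  have fm: "{u..v} \<inter> block Q c \<rho> n \<in> fmeasurable lborel" for n
    unfolding block_def by (simp add: fmeasurable_compact)
  have fmc: "{u..v} \<inter> comb Q c \<rho> \<in> fmeasurable lborel"
    unfolding eq by (intro fmeasurable.finite_UN fm) (simp add: I_def)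
  have uv: "Q * u \<le> Q * v"
    using True assms(1) by (intro mult_left_mono) auto
  have "measure lborel ({u..v} \<inter> comb Q c \<rho>) \<le> (\<Sum>n\<in>I. measure lborel ({u..v} \<inter> block Q c \<rho> n))"
    unfolding eq by (intro measure_UNION_le fmeasurableD fm) (simp add: I_def)
  also have "\<dots> \<le> (\<Sum>n\<in>I. measure lborel (block Q c \<rho> n))"
    by (intro sum_mono measure_mono_fmeasurable fmeasurableD fm) auto
  also have "\<dots> = real (card I) * (\<rho> / Q)"
    using assms by (simp add: measure_block)
  also have "\<dots> \<le> (Q * (v - u) + 2) * (\<rho> / Q)"
  proof (rule mult_right_mono)
    have "real (card I) = max 0 (of_int (\<lfloor>Q * v - c\<rfloor> + 1 - \<lceil>Q * u - c - \<rho>\<rceil>))"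
      by (simp add: I_def)
    then show "real (card I) \<le> Q * (v - u) + 2"
      using uv assms(3) unfolding right_diff_distrib by linarith
  qed (use assms in simp)
  finally have upper: "measure lborel ({u..v} \<inter> comb Q c \<rho>) \<le> (Q * (v - u) + 2) * (\<rho> / Q)" .
  have "(Q * (v - u) - 2) * (\<rho> / Q) \<le> real (card J) * (\<rho> / Q)"
  proof (rule mult_right_mono)
    have "real (card J) = max 0 (of_int (\<lfloor>Q * v - c - \<rho>\<rfloor> + 1 - \<lceil>Q * u - c\<rceil>))"
      by (simp add: J_def)
    then show "Q * (v - u) - 2 \<le> real (card J)"
      using assms(3) unfolding right_diff_distrib by linarith
  qed (use assms in simp)
  also have "\<dots> = (\<Sum>n\<in>J. measure lborel (block Q c \<rho> n))"
    using assms by (simp add: measure_block)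
  also have "\<dots> = measure lborel (\<Union>n\<in>J. block Q c \<rho> n)"
    using assms by (intro measure_UNION'[symmetric]) (auto simp: J_def pairwise_def intro: disjoint_block)
  also have "\<dots> \<le> measure lborel ({u..v} \<inter> comb Q c \<rho>)"
  proof (rule measure_mono_fmeasurable[OF _ _ fmc])
    have "block Q c \<rho> n \<subseteq> {u..v}" if "n \<in> J" for n
    proof -
      have "Q * u - c \<le> of_int n" "of_int n \<le> Q * v - c - \<rho>"
        using that by (auto simp: J_def ceiling_le_iff le_floor_iff)
      then show ?thesis
        using assms(1) by (auto simp: block_def field_simps)
    qed
    then show "(\<Union>n\<in>J. block Q c \<rho> n) \<subseteq> {u..v} \<inter> comb Q c \<rho>"
      using assms by (auto simp: comb_eq_UN block_def[symmetric])
  qed (auto intro!: sets.finite_UN simp: J_def block_def)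
  finally have lower: "(Q * (v - u) - 2) * (\<rho> / Q) \<le> measure lborel ({u..v} \<inter> comb Q c \<rho>)" .
  show ?thesis
    using upper lower True assms(1) by (simp add: field_simps abs_le_iff)
qed (use assms in auto)

text \<open>The complexity \<open>N\<close> is essentially the number of components of \<open>E\<close>.\<close>
definition equidistributed :: "real \<Rightarrow> real set \<Rightarrow> bool" where
  "equidistributed N E \<longleftrightarrow> (\<forall>u v Q c \<rho>. 0 < Q \<longrightarrow> 0 < \<rho> \<longrightarrow> \<rho> < 1 \<longrightarrow>
    \<bar>measure lborel (E \<inter> {u..v} \<inter> comb Q c \<rho>) - \<rho> * measure lborel (E \<inter> {u..v})\<bar> \<le> \<rho> * N / Q)"

lemma equidistributed_Icc: "equidistributed 2 {a..b}"
  unfolding equidistributed_def Int_atLeastAtMost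
proof (intro allI impI)
  fix u v Q c \<rho> :: real
  assume "0 < Q" "0 < \<rho>" "\<rho> < 1"
  from measure_Icc_Int_comb[OF this, of "max a u" "min b v" c]
  show "\<bar>measure lborel ({max a u..min b v} \<inter> comb Q c \<rho>) - \<rho> * measure lborel {max a u..min b v}\<bar> \<le> \<rho> * 2 / Q"
    by (simp only: mult.commute)
qed

lemma compact_Int_comb:
  assumes "compact E" "0 < Q" "0 \<le> \<rho>" "\<rho> < 1"
  shows "compact (E \<inter> comb Q c \<rho>)"
proof -
  obtain a where "E \<subseteq> {-a..a}"
    using assms(1) bounded_subset_cbox_symmetric[of E] compact_imp_bounded by (auto simp: cbox_interval)
  then have "E \<inter> comb Q c \<rho> = E \<inter> (\<Union>n\<in>{\<lceil>Q * -a - c - \<rho>\<rceil>..\<lfloor>Q * a - c\<rfloor>}. block Q c \<rho> n)"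
    using Int_comb_eq[OF assms(2-4), of E "-a" a c] by blast
  also have "compact \<dots>"
    using assms(1) by (intro compact_Int_closed closed_UN) (auto simp: block_def)
  finally show ?thesis .
qed

text \<open>Each tooth cuts \<open>E\<close> in the trace of an interval, to which the hypothesis
  applies because it quantifies over all \<open>u\<close> and \<open>v\<close>. At most
  \<open>Q + 2\<close> teeth are involved, and their errors add up.\<close>

lemma equidistributed_Int_comb:
  assumes E: "equidistributed N E" "compact E" "E \<subseteq> {0..1}" and "0 \<le> N"
    and Q: "0 < Q" "0 < \<rho>" "\<rho> < 1"
  shows "equidistributed (N * (Q + 2)) (E \<inter> comb Q c \<rho>)"
  unfolding equidistributed_def
proof (intro allI impI)
  fix u v Q' c' \<rho>' :: real
  assume Q': "0 < Q'" "0 < \<rho>'" "\<rho>' < 1"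
  define I where "I = {\<lceil>Q * 0 - c - \<rho>\<rceil>..\<lfloor>Q * 1 - c\<rfloor>}"
  define F where "F n = E \<inter> {u..v} \<inter> block Q c \<rho> n" for n
  have F_eq: "F n = E \<inter> {max u ((of_int n + c) / Q)..min v ((of_int n + c + \<rho>) / Q)}" for n
    by (auto simp: F_def block_def)
  have eq: "E \<inter> comb Q c \<rho> \<inter> {u..v} = (\<Union>n\<in>I. F n)"
    using Int_comb_eq[of Q \<rho> E 0 1 c] assms unfolding I_def F_def by auto
  have F: "F n \<in> fmeasurable lborel" for n
    unfolding F_eq using E(2) by (intro fmeasurable_compact compact_Int) auto
  have Fc: "F n \<inter> comb Q' c' \<rho>' \<in> fmeasurable lborel" for n
    unfolding F_eq using E(2) Q' by (intro fmeasurable_compact compact_Int_comb compact_Int) auto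
  have disj: "pairwise (\<lambda>m n. disjnt (F m) (F n)) I"
    using disjoint_block[OF Q(1,3)] unfolding pairwise_def F_def disjnt_iff by blast
  have eqF: "measure lborel (\<Union>n\<in>I. F n) = (\<Sum>n\<in>I. measure lborel (F n))"
    using F disj by (intro measure_UNION') (auto simp: I_def)
  have eqFc: "measure lborel (\<Union>n\<in>I. F n \<inter> comb Q' c' \<rho>') =
      (\<Sum>n\<in>I. measure lborel (F n \<inter> comb Q' c' \<rho>'))"
    using Fc disj by (intro measure_UNION') (auto simp: I_def pairwise_def disjnt_iff)
  have eqc: "E \<inter> comb Q c \<rho> \<inter> {u..v} \<inter> comb Q' c' \<rho>' = (\<Union>n\<in>I. F n \<inter> comb Q' c' \<rho>')"
    using eq by blast
  have "\<bar>measure lborel (E \<inter> comb Q c \<rho> \<inter> {u..v} \<inter> comb Q' c' \<rho>')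
      - \<rho>' * measure lborel (E \<inter> comb Q c \<rho> \<inter> {u..v})\<bar>
    = \<bar>\<Sum>n\<in>I. measure lborel (F n \<inter> comb Q' c' \<rho>') - \<rho>' * measure lborel (F n)\<bar>"
    unfolding eqc unfolding eq eqF eqFc by (simp only: sum_subtractf sum_distrib_left)
  also have "\<dots> \<le> (\<Sum>n\<in>I. \<bar>measure lborel (F n \<inter> comb Q' c' \<rho>') - \<rho>' * measure lborel (F n)\<bar>)"
    by (rule sum_abs)
  also have "\<dots> \<le> (\<Sum>n\<in>I. \<rho>' * N / Q')"
    using E(1)[unfolded equidistributed_def, rule_format, OF Q'] unfolding F_eq
    by (intro sum_mono)
  also have "\<dots> = real (card I) * (\<rho>' * N / Q')"
    by simp
  also have "\<dots> \<le> (Q + 2) * (\<rho>' * N / Q')"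
  proof (rule mult_right_mono)
    have "real (card I) = max 0 (of_int (\<lfloor>Q * 1 - c\<rfloor> + 1 - \<lceil>Q * 0 - c - \<rho>\<rceil>))"
      by (simp add: I_def)
    then show "real (card I) \<le> Q + 2"
      using Q by linarith
  qed (use assms Q' in simp)
  finally show "\<bar>measure lborel (E \<inter> comb Q c \<rho> \<inter> {u..v} \<inter> comb Q' c' \<rho>')
      - \<rho>' * measure lborel (E \<inter> comb Q c \<rho> \<inter> {u..v})\<bar> \<le> \<rho>' * (N * (Q + 2)) / Q'"
    by (simp add: mult_ac)
qed

section \<open>Dimension of intersections of combs\<close>

lemma compact_decseq_subset_open:
  fixes E :: "nat \<Rightarrow> 'a::euclidean_space set"
  assumes "\<And>k. compact (E k)" and decr: "decseq E"
    and "(\<Inter>k. E k) \<subseteq> T" "open T"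
  shows "\<exists>k. E k \<subseteq> T"
proof (rule ccontr)
  assume "\<nexists>k. E k \<subseteq> T"
  then have "\<Inter> (range (\<lambda>k. E k - T)) \<noteq> {}"
    using assms by (intro compact_nest compact_diff) (auto dest: decseqD)
  with assms(3) show False
    by blast
qed

lemma doubled_sum_powr_le:
  fixes d \<tau> s :: real
  assumes "0 \<le> d" "0 \<le> \<tau>" "0 < s" "s \<le> 1"
  shows "(2 * (d + \<tau>)) powr s \<le> 4 * (d powr s + \<tau> powr s)"
proof -
  have "(2 * (d + \<tau>)) powr s \<le> (4 * max d \<tau>) powr s"
    using assms by (intro powr_mono2) auto
  also have "\<dots> = 4 powr s * max d \<tau> powr s"
    by (simp add: powr_mult)
  also have "\<dots> \<le> 4 * (d powr s + \<tau> powr s)"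
    using assms powr_mono[of s 1 4] by (intro mult_mono) (auto simp: max_def)
  finally show ?thesis .
qed

text \<open>Below diameter 1 a larger exponent gives a smaller power. The strict gap between
  \<open>t\<close> and \<open>s\<close> also absorbs the convention that a nonempty set has gauge 1
  at exponent 0.\<close>

lemma ennreal_powr_le_diam_gauge:
  assumes "bounded U" "diameter U \<le> 1" "t < s"
  shows "ennreal (diameter U powr s) \<le> diam_gauge t U"
proof -
  have d: "0 \<le> diameter U"
    using assms(1) by (rule diameter_ge_0)
  have "diameter U powr s \<le> diameter U powr t"
    using powr_mono'[of t s "diameter U"] assms d by simp
  moreover have "diameter U powr s \<le> 1" if "t = 0"
    using that assms d by (intro powr_le1) auto
  ultimately show ?thesis
    by (auto simp: diam_gauge_def ennreal_leI simp del: ennreal_1 simp flip: ennreal_1)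
qed

text \<open>A mass distribution principle in which the measures are the normalised Lebesgue measures on
  the approximating sets \<open>E k\<close>, so that no limit measure on \<open>\<Inter>k. E k\<close> is needed.\<close>
lemma hausdorff_measure_neq_0:
  fixes E :: "nat \<Rightarrow> real set" and P :: "nat \<Rightarrow> real"
  assumes compact: "\<And>k. compact (E k)" and decr: "decseq E" and A: "(\<Inter>k. E k) \<subseteq> A"
    and P: "\<And>k. 0 < P k" and "0 < c" "0 < C"
    and lower: "\<And>k. k0 \<le> k \<Longrightarrow> c * P k \<le> measure lborel (E k)"
    and upper: "\<And>k u v. k0 \<le> k \<Longrightarrow> u < v \<Longrightarrow>
      measure lborel (E k \<inter> {u..v}) \<le> C * P k * (v - u) powr s"
    and s: "t < s" "0 < s" "s \<le> 1"
  shows "hausdorff_measure t A \<noteq> 0"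
proof
  assume "hausdorff_measure t A = 0"
  \<comment> \<open>Chosen so that the final upper bound \<open>4 * C * P k * (e + e)\<close> is
    half of the lower bound \<open>c * P k\<close>.\<close>
  define e where "e = c / (16 * C)"
  have e: "0 < e"
    using \<open>0 < c\<close> \<open>0 < C\<close> by (simp add: e_def)
  have "hausdorff_premeasure t 1 A \<le> hausdorff_measure t A"
    unfolding hausdorff_measure_def by (intro SUP_upper) simp
  with \<open>hausdorff_measure t A = 0\<close> e have "hausdorff_premeasure t 1 A < ennreal e"
    by simp
  then obtain U where U: "U \<in> delta_covers 1 A" and sumU: "(\<Sum>i. diam_gauge t (U i)) < ennreal e"
    unfolding hausdorff_premeasure_def INF_less_iff by blast
  have bdd: "bounded (U i)" and diam: "diameter (U i) \<le> 1" for i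
    using U by (auto simp: delta_covers_def)
  define d where "d i = diameter (U i)" for i
  \<comment> \<open>Fattening by \<open>\<tau> i\<close> encloses \<open>U i\<close> in an open
    interval even when its diameter is 0; the powers \<open>\<tau> i powr s\<close> form a geometric
    series with sum \<open>e\<close>.\<close>
  define \<tau> where "\<tau> i = (e * (1 / 2) ^ Suc i) powr (1 / s)" for i
  have d: "0 \<le> d i" for i
    unfolding d_def using bdd by (rule diameter_ge_0)
  have \<tau>: "0 < \<tau> i" "\<tau> i powr s = e * (1 / 2) ^ Suc i" for i
    using e s by (simp_all add: \<tau>_def powr_powr del: power_Suc)
  have "\<exists>x. U i \<subseteq> {x - (d i + \<tau> i)<..<x + (d i + \<tau> i)}" for i
  proof (cases "U i = {}")
    case False
    then obtain x where x: "x \<in> U i"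
      by blast
    have "\<bar>x - y\<bar> < d i + \<tau> i" if "y \<in> U i" for y
      using diameter_bounded_bound[OF bdd x that] \<tau>(1)[of i] by (simp add: d_def dist_real_def)
    then have "U i \<subseteq> {x - (d i + \<tau> i)<..<x + (d i + \<tau> i)}"
      by (force simp: abs_less_iff)
    then show ?thesis ..
  qed simp
  then obtain x where x: "\<And>i. U i \<subseteq> {x i - (d i + \<tau> i)<..<x i + (d i + \<tau> i)}"
    by metis
  have "(\<Inter>k. E k) \<subseteq> (\<Union>i. {x i - (d i + \<tau> i)<..<x i + (d i + \<tau> i)})"
  proof -
    have "A \<subseteq> (\<Union>i. U i)"
      using U by (simp add: delta_covers_def)
    also have "\<dots> \<subseteq> (\<Union>i. {x i - (d i + \<tau> i)<..<x i + (d i + \<tau> i)})"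
      using x by (intro UN_mono) auto
    finally show ?thesis
      using A by (rule subset_trans[rotated])
  qed
  \<comment> \<open>Compactness transfers the cover from the intersection to a single stage; its
    infinitely many members are then handled by countable subadditivity.\<close>
  from compact_decseq_subset_open[OF compact decr this]
  obtain k1 where "E k1 \<subseteq> (\<Union>i. {x i - (d i + \<tau> i)<..<x i + (d i + \<tau> i)})"
    by (auto simp: open_UN)
  moreover define k where "k = max k0 k1"
  ultimately have cover: "E k \<subseteq> (\<Union>i. {x i - (d i + \<tau> i)<..<x i + (d i + \<tau> i)})" and k: "k0 \<le> k"
    using decseqD[OF decr, of k1 k] by auto
  define J where "J i = E k \<inter> {x i - (d i + \<tau> i)..x i + (d i + \<tau> i)}" for i
  have J: "J i \<in> fmeasurable lborel" for i
    unfolding J_def using compact by (intro fmeasurable_compact compact_Int) auto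
  have EJ: "E k = (\<Union>i. J i)"
  proof -
    have "(\<Union>i. {x i - (d i + \<tau> i)<..<x i + (d i + \<tau> i)})
        \<subseteq> (\<Union>i. {x i - (d i + \<tau> i)..x i + (d i + \<tau> i)})"
      by (intro UN_mono greaterThanLessThan_subseteq_atLeastAtMost_iff[THEN iffD2]) auto
    with cover show ?thesis
      unfolding J_def by blast
  qed
  have measJ: "measure lborel (J i) \<le> 4 * C * P k * (d i powr s + \<tau> i powr s)" for i
  proof -
    have "measure lborel (J i) \<le> C * P k * (2 * (d i + \<tau> i)) powr s"
      using upper[OF k, of "x i - (d i + \<tau> i)" "x i + (d i + \<tau> i)"] d[of i] \<tau>(1)[of i]
      by (simp add: J_def)
    also have "\<dots> \<le> C * P k * (4 * (d i powr s + \<tau> i powr s))"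
      using doubled_sum_powr_le[of "d i" "\<tau> i" s] d[of i] \<tau>(1)[of i] s \<open>0 < C\<close> P[of k]
      by (intro mult_left_mono) auto
    finally show ?thesis
      by (simp add: mult_ac)
  qed
  have "ennreal (c * P k) \<le> ennreal (measure lborel (E k))"
    using lower[OF k] by (rule ennreal_leI)
  also have "\<dots> = emeasure lborel (E k)"
    using fmeasurable_compact[OF compact] by (simp add: emeasure_eq_measure2 fmeasurableD2)
  also have "\<dots> \<le> (\<Sum>i. emeasure lborel (J i))"
    unfolding EJ by (intro emeasure_subadditive_countably image_subsetI fmeasurableD J)
  also have "\<dots> \<le> (\<Sum>i. ennreal (4 * C * P k) * (diam_gauge t (U i) + ennreal (e * (1 / 2) ^ Suc i)))"
  proof (intro suminf_le)
    fix i
    have "emeasure lborel (J i) = ennreal (measure lborel (J i))"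
      using J by (simp add: emeasure_eq_measure2 fmeasurableD2)
    also have "\<dots> \<le> ennreal (4 * C * P k * (d i powr s + \<tau> i powr s))"
      using measJ by (rule ennreal_leI)
    also have "\<dots> = ennreal (4 * C * P k) * (ennreal (d i powr s) + ennreal (\<tau> i powr s))"
      using \<open>0 < C\<close> P[of k] by (simp add: ennreal_mult)
    also have "\<dots> \<le> ennreal (4 * C * P k) * (diam_gauge t (U i) + ennreal (e * (1 / 2) ^ Suc i))"
      using ennreal_powr_le_diam_gauge[OF bdd diam s(1), of i] unfolding \<tau>(2) d_def
      by (intro mult_left_mono add_mono) auto
    finally show "emeasure lborel (J i)
        \<le> ennreal (4 * C * P k) * (diam_gauge t (U i) + ennreal (e * (1 / 2) ^ Suc i))" .
  qed auto
  also have "\<dots> = ennreal (4 * C * P k) * ((\<Sum>i. diam_gauge t (U i)) + ennreal e)"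
  proof -
    have "(\<Sum>i. ennreal (e * (1 / 2) ^ Suc i)) = ennreal e"
      using sums_mult[OF power_half_series, of e] e by (intro suminf_ennreal_eq) auto
    then show ?thesis
      by (simp add: suminf_add[symmetric] del: power_Suc)
  qed
  also have "\<dots> \<le> ennreal (4 * C * P k) * (ennreal e + ennreal e)"
    using sumU by (intro mult_left_mono add_right_mono) auto
  also have "\<dots> = ennreal (c * P k / 2)"
    using e P[of k] \<open>0 < C\<close> by (simp flip: ennreal_plus ennreal_mult) (simp add: e_def field_simps)
  finally show False
    using P[of k] \<open>0 < c\<close> by (simp add: ennreal_le_iff)
qed

text \<open>Each new comb changes the normalised mass of an interval only by a rapidly decreasing
  amount. A bound obtained at the stage matching the length of the interval therefore persists at
  all later stages.\<close>

lemma hausdorff_dim_comb_Int_ge: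
  fixes Q c \<rho> :: "nat \<Rightarrow> real" and \<gamma> \<kappa> :: real
  assumes "0 \<le> \<gamma>" "0 < \<kappa>"
    and Q: "\<And>k. 0 < Q k" and \<rho>: "\<And>k. 0 < \<rho> k" "\<And>k. \<rho> k \<le> 1 / 8"
    and \<rho>_ge: "\<And>k. \<kappa> * Q k powr (- \<gamma>) \<le> \<rho> k"
    and sparse: "\<And>k. 2 * (\<Prod>i<k. Q i + 2) \<le> Q k * (\<Prod>i<k. \<rho> i) ^ (k + 2) / 8"
    and A: "{0..1/2} \<inter> (\<Inter>k. comb (Q k) (c k) (\<rho> k)) \<subseteq> A"
  shows "ereal (1 / (1 + \<gamma>)) \<le> hausdorff_dim A"
proof -
  define P where "P k = (\<Prod>i<k. \<rho> i)" for k
  define N where "N k = 2 * (\<Prod>i<k. Q i + 2)" for k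
  define E where "E k = {0..1/2} \<inter> (\<Inter>i<k. comb (Q i) (c i) (\<rho> i))" for k
  \<comment> \<open>By \<open>sparse\<close>, the normalised discrepancy
    \<open>N k / (Q k * P k)\<close> is at most \<open>\<eta> k\<close>. The exponent
    \<open>k + 1\<close> grows so that any fixed positive power of \<open>P k ^ (k + 1)\<close>
    eventually beats the factor \<open>1 / P k\<close> in \<open>local\<close>.\<close>
  define \<eta> where "\<eta> k = P k ^ (k + 1) / 8" for k
  define m where "m k u v = measure lborel (E k \<inter> {u..v}) / P k" for k u v
  define a where "a = 1 / (1 + \<gamma>)"
  have a: "0 < a" "a \<le> 1" "1 - a * \<gamma> = a"
    using \<open>0 \<le> \<gamma>\<close> by (simp_all add: a_def field_simps)
  have \<rho>1: "\<rho> k < 1" for k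
    using \<rho>(2)[of k] by linarith
  have P0: "P 0 = 1" and PSuc: "P (Suc k) = P k * \<rho> k" for k
    by (simp_all add: P_def)
  have P: "0 < P k" for k
    unfolding P_def using \<rho> by (intro prod_pos) auto
  have P1: "P k \<le> 1" for k
    unfolding P_def using \<rho>(1) \<rho>1 by (intro prod_le_1) (auto intro: less_imp_le)
  have E0: "E 0 = {0..1/2}" and ESuc: "E (Suc k) = E k \<inter> comb (Q k) (c k) (\<rho> k)" for k
    by (auto simp: E_def lessThan_Suc)
  have E: "compact (E k)" "E k \<subseteq> {0..1}" for k
  proof -
    show "compact (E k)"
    proof (induction k)
      case (Suc k)
      then show ?case
        unfolding ESuc using Q \<rho>(1) \<rho>1 by (intro compact_Int_comb) (auto intro: less_imp_le)
    qed (simp add: E0)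
  qed (auto simp: E_def)
  have "0 \<le> Q k + 2" for k
    using Q[of k] by linarith
  then have N: "0 \<le> N k" for k
    unfolding N_def by (intro mult_nonneg_nonneg prod_nonneg) auto
  have equi: "equidistributed (N k) (E k)" for k
  proof (induction k)
    case 0
    show ?case
      using equidistributed_Icc by (simp add: N_def E0)
  next
    case (Suc k)
    then have "equidistributed (N k * (Q k + 2)) (E (Suc k))"
      unfolding ESuc using E N Q \<rho>(1) \<rho>1 by (intro equidistributed_Int_comb)
    then show ?case
      by (simp add: N_def mult_ac)
  qed
  have fm: "E k \<inter> {u..v} \<in> fmeasurable lborel" for k u v
    using E(1) by (intro fmeasurable_compact compact_Int) auto
  have \<eta>_Suc: "2 * \<eta> (Suc k) \<le> \<eta> k" for k
  proof -
    have "P (Suc k) ^ (k + 2) \<le> (P k / 8) ^ (k + 2)"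
      using \<rho>[of k] P[of k] unfolding PSuc by (intro power_mono) (auto simp: field_simps)
    also have "\<dots> = P k ^ (k + 1) * (P k * (1 / 8) ^ (k + 2))"
      by (simp add: power_divide field_simps)
    also have "\<dots> \<le> P k ^ (k + 1) * (1 * (1 / 8) ^ 1)"
      using P P1 by (intro mult_left_mono mult_mono power_decreasing) (auto intro: less_imp_le)
    finally show ?thesis
      using zero_less_power[OF P, of "Suc k" "k + 2"] by (simp add: \<eta>_def)
  qed
  have step: "\<bar>m (Suc k) u v - m k u v\<bar> \<le> \<eta> k" for k u v
  proof -
    have "N k / Q k \<le> \<eta> k * P k"
      using sparse[of k] Q[of k] by (simp add: N_def P_def \<eta>_def field_simps)
    then have "\<rho> k * (N k / Q k) \<le> \<rho> k * (\<eta> k * P k)"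
      using \<rho>(1)[of k] by (intro mult_left_mono) auto
    moreover have "\<bar>measure lborel (E k \<inter> {u..v} \<inter> comb (Q k) (c k) (\<rho> k))
        - \<rho> k * measure lborel (E k \<inter> {u..v})\<bar> \<le> \<rho> k * N k / Q k"
      using equi[of k] Q \<rho>(1) \<rho>1 unfolding equidistributed_def by blast
    moreover have "E k \<inter> {u..v} \<inter> comb (Q k) (c k) (\<rho> k) = E (Suc k) \<inter> {u..v}"
      unfolding ESuc by blast
    ultimately have "\<bar>measure lborel (E (Suc k) \<inter> {u..v}) - \<rho> k * measure lborel (E k \<inter> {u..v})\<bar>
        \<le> P (Suc k) * \<eta> k"
      by (simp add: PSuc mult_ac)
    moreover have "m (Suc k) u v - m k u v =
        (measure lborel (E (Suc k) \<inter> {u..v}) - \<rho> k * measure lborel (E k \<inter> {u..v})) / P (Suc k)"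
      using P[of k] \<rho>(1)[of k] by (simp add: m_def PSuc field_simps)
    ultimately show ?thesis
      using P[of "Suc k"] by (simp add: abs_divide pos_divide_le_eq mult.commute)
  qed
  \<comment> \<open>As \<open>\<eta>\<close> at least halves at each stage,
    \<open>2 * \<eta> k\<close> dominates all remaining changes; adding or subtracting it makes the
    mass monotone in \<open>k\<close>.\<close>
  have m_decr: "m (Suc k) u v + 2 * \<eta> (Suc k) \<le> m k u v + 2 * \<eta> k" for k u v
    using step[of k u v] \<eta>_Suc[of k] by linarith
  have m_incr: "m k u v - 2 * \<eta> k \<le> m (Suc k) u v - 2 * \<eta> (Suc k)" for k u v
    using step[of k u v] \<eta>_Suc[of k] by linarith
  have \<eta>0: "\<eta> 0 = 1 / 8" and \<eta>_pos: "0 < \<eta> k" for k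
    using P by (simp_all add: \<eta>_def P0)
  have m_le_1: "m k u v \<le> 1" for k u v
  proof -
    have "m k u v + 2 * \<eta> k \<le> m 0 u v + 2 * \<eta> 0"
      using m_decr by (rule lift_Suc_antimono_le[of "\<lambda>k. m k u v + 2 * \<eta> k"]) simp
    moreover have "measure lborel ({0..1/2} \<inter> {u..v}) \<le> measure lborel {0..1/2::real}"
      by (intro measure_mono_fmeasurable) (auto simp: fmeasurable_compact)
    then have "m 0 u v \<le> 1 / 2"
      by (simp add: m_def P0 E0 del: Int_atLeastAtMost)
    ultimately show ?thesis
      using \<eta>_pos[of k] \<eta>0 by linarith
  qed
  \<comment> \<open>The initial mass is \<open>1/2\<close> and the total drift is at most
    \<open>2 * \<eta> 0 = 1/4\<close>.\<close>
  have lower: "1 / 4 * P k \<le> measure lborel (E k)" for k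
  proof -
    have "m 0 0 1 - 2 * \<eta> 0 \<le> m k 0 1 - 2 * \<eta> k"
      using m_incr by (rule lift_Suc_mono_le[of "\<lambda>k. m k 0 1 - 2 * \<eta> k"]) simp
    moreover have "m 0 0 1 = 1 / 2"
      by (simp add: m_def P0 E0)
    ultimately have "1 / 4 \<le> m k 0 1"
      using \<eta>_pos[of k] \<eta>0 by linarith
    moreover have "E k \<inter> {0..1} = E k"
      using E(2) by blast
    ultimately show ?thesis
      using P[of k] by (simp add: m_def field_simps)
  qed
  define C1 where "C1 = 3 + 1 / \<kappa>"
  text \<open>A short interval carries at most the mass of its own length, a longer one at most that of a
    bounded number of teeth of the last comb; the two bounds balance at length
    \<open>Q k powr (- (1 + \<gamma>))\<close>, which produces the exponent \<open>a\<close>.\<close>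
  have local: "m (Suc k) u v \<le> C1 * (v - u) powr a / P k" if uv: "u < v" "v - u \<le> 1" for k u v
  proof -
    define l where "l = v - u"
    have l: "0 < l" "l \<le> 1"
      using uv by (simp_all add: l_def)
    have "l \<le> l powr a"
      using powr_mono'[of a 1 l] a l by simp
    show ?thesis
    proof (cases "1 \<le> l powr a * Q k")
      case True
      have "measure lborel (E (Suc k) \<inter> {u..v}) \<le> measure lborel ({u..v} \<inter> comb (Q k) (c k) (\<rho> k))"
        using Q \<rho>(1) \<rho>1
        by (intro measure_mono_fmeasurable fmeasurableD[OF fm] fmeasurable_compact compact_Int_comb)
          (auto simp: ESuc intro: less_imp_le)
      also have "\<dots> \<le> \<rho> k * l + 2 * \<rho> k / Q k"
        using measure_Icc_Int_comb[of "Q k" "\<rho> k" u v "c k"] Q \<rho>(1) \<rho>1 uv by (simp add: l_def)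
      also have "\<dots> = \<rho> k * (l + 2 * (1 / Q k))"
        by (simp add: algebra_simps)
      also have "\<dots> \<le> \<rho> k * (3 * l powr a)"
      proof -
        have "1 / Q k \<le> l powr a"
          using True Q[of k] by (simp add: field_simps)
        then show ?thesis
          using \<open>l \<le> l powr a\<close> \<rho>(1)[of k] by (intro mult_left_mono) auto
      qed
      finally have "m (Suc k) u v \<le> 3 * l powr a / P k"
        using P[of k] \<rho>(1)[of k] by (simp add: m_def PSuc field_simps)
      also have "\<dots> \<le> C1 * l powr a / P k"
        using P[of k] \<open>0 < \<kappa>\<close> by (intro divide_right_mono mult_right_mono) (auto simp: C1_def)
      finally show ?thesis
        by (simp add: l_def)
    next
      case False
      have "measure lborel (E (Suc k) \<inter> {u..v}) \<le> measure lborel {u..v}"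
        by (intro measure_mono_fmeasurable fmeasurableD[OF fm]) (auto simp: fmeasurable_compact)
      then have "measure lborel (E (Suc k) \<inter> {u..v}) \<le> l"
        using uv by (simp add: l_def)
      then have "m (Suc k) u v \<le> l / (P k * \<rho> k)"
        using P[of "Suc k"] by (simp add: m_def PSuc divide_right_mono)
      also have "\<dots> \<le> l / (P k * (\<kappa> * Q k powr (- \<gamma>)))"
        using \<rho>_ge[of k] \<rho>(1)[of k] P[of k] l \<open>0 < \<kappa>\<close> Q[of k]
        by (intro divide_left_mono mult_left_mono mult_pos_pos) auto
      also have "\<dots> = l * Q k powr \<gamma> / (\<kappa> * P k)"
        by (simp add: powr_minus field_simps)
      also have "\<dots> \<le> l * (l powr (- a)) powr \<gamma> / (\<kappa> * P k)"
      proof -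
        have "Q k \<le> l powr (- a)"
          using False l by (simp add: powr_minus field_simps)
        then show ?thesis
          using Q[of k] \<open>0 \<le> \<gamma>\<close> P[of k] \<open>0 < \<kappa>\<close> l
          by (intro divide_right_mono mult_left_mono powr_mono2) auto
      qed
      also have "l * (l powr (- a)) powr \<gamma> = l powr (1 - a * \<gamma>)"
        using l powr_add[of l 1 "- a * \<gamma>"] by (simp add: powr_powr)
      also have "\<dots> = l powr a"
        unfolding a(3) ..
      also have "l powr a / (\<kappa> * P k) = 1 / \<kappa> * l powr a / P k"
        by simp
      also have "\<dots> \<le> C1 * l powr a / P k"
        using P[of k] by (intro divide_right_mono mult_right_mono) (auto simp: C1_def)
      finally show ?thesis
        by (simp add: l_def)
    qed
  qed
  have C1: "0 < C1"
    using \<open>0 < \<kappa>\<close> by (simp add: C1_def add_pos_pos)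
  have "hausdorff_measure t A \<noteq> 0" if t: "0 \<le> t" "t < a" for t
  proof -
    define s where "s = (t + a) / 2"
    have s: "t < s" "s < a" "0 < s" "s \<le> 1"
      using t a by (auto simp: s_def)
    obtain k0 :: nat where k0: "1 / (a - s) \<le> real k0"
      using real_arch_simple by blast
    define scale where "scale k = P k ^ (k + 1)" for k
    have scale: "0 < scale k" "scale k \<le> 1" for k
      using P[of k] P1[of k] by (auto simp: scale_def intro!: power_le_one mult_le_one)
    \<comment> \<open>By the choice of \<open>k0\<close>, the spare factor
      \<open>(v - u) powr (a - s)\<close> is at most \<open>P k\<close>, which cancels the division
      by \<open>P k\<close> in \<open>local\<close>.\<close>
    have direct: "m (Suc k) u v \<le> C1 * (v - u) powr s"
      if k: "k0 \<le> k" and uv: "u < v" "v - u \<le> scale k" for k u v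
    proof -
      have "1 / (a - s) \<le> real (k + 1)"
        using k0 k by simp
      then have exponent: "1 \<le> real (k + 1) * (a - s)"
        using s by (simp add: field_simps)
      have "(v - u) powr a = (v - u) powr s * (v - u) powr (a - s)"
        by (simp add: powr_add[symmetric])
      also have "(v - u) powr (a - s) \<le> scale k powr (a - s)"
        using uv s by (intro powr_mono2) auto
      also have "scale k powr (a - s) = P k powr (real (k + 1) * (a - s))"
        using P[of k] by (simp only: scale_def powr_realpow[symmetric] powr_powr)
      also have "\<dots> \<le> P k powr 1"
        using P[of k] P1[of k] exponent by (intro powr_mono') auto
      finally have "(v - u) powr a \<le> (v - u) powr s * P k"
        using P[of k] by (simp add: mult_left_mono)
      then have "C1 * (v - u) powr a / P k \<le> C1 * (v - u) powr s"
        using P[of k] C1 by (simp add: field_simps)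
      then show ?thesis
        using local[of u v k] uv scale(2)[of k] by linarith
    qed
    \<comment> \<open>At the stage where the scale drops below the length of the interval,
      \<open>direct\<close> still bounds the mass, and the drift \<open>2 * \<eta> (Suc k)\<close>
      is less than \<open>v - u\<close>, which the extra 1 in \<open>C1 + 1\<close> pays for.
      Afterwards \<open>m_decr\<close> preserves the bound. At \<open>k0\<close> the claim is
      vacuous.\<close>
    have below: "scale k < v - u \<longrightarrow> m (Suc k) u v + 2 * \<eta> (Suc k) \<le> (C1 + 1) * (v - u) powr s"
      if "k0 \<le> k" and uv: "u < v" "v - u \<le> scale k0" for k u v
      using that(1)
    proof (induction k rule: dec_induct)
      case base
      show ?case
        using uv by simp
    next
      case (step k)
      show ?case
      proof
        assume large: "scale (Suc k) < v - u"
        show "m (Suc (Suc k)) u v + 2 * \<eta> (Suc (Suc k)) \<le> (C1 + 1) * (v - u) powr s"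
        proof (cases "scale k < v - u")
          case True
          with step.IH m_decr[of "Suc k" u v] show ?thesis
            by linarith
        next
          case False
          have "v - u \<le> (v - u) powr s"
            using powr_mono'[of s 1 "v - u"] uv s scale(2)[of k0] by simp
          moreover have "2 * \<eta> (Suc k) \<le> scale (Suc k)"
            using scale(1)[of "Suc k"] by (simp add: \<eta>_def scale_def)
          moreover have "m (Suc k) u v \<le> C1 * (v - u) powr s"
            using direct[of k u v] step uv False by simp
          ultimately show ?thesis
            using m_decr[of "Suc k" u v] large by (simp add: algebra_simps)
        qed
      qed
    qed
    \<comment> \<open>The last summand serves intervals longer than \<open>scale k0\<close>, where
      the mass is simply bounded by 1.\<close>
    define C where "C = C1 + 1 + 1 / scale k0"
    have mC: "m (Suc k) u v \<le> C * (v - u) powr s" if k: "k0 \<le> k" and uv: "u < v" for k u v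
    proof -
      have "m (Suc k) u v \<le> (C1 + 1) * (v - u) powr s \<or> m (Suc k) u v \<le> 1 / scale k0 * (v - u) powr s"
      proof (cases "v - u \<le> scale k0")
        case True
        have "C1 * (v - u) powr s \<le> (C1 + 1) * (v - u) powr s"
          by (intro mult_right_mono) auto
        then show ?thesis
          using below[OF k uv True] direct[OF k uv] \<eta>_pos[of "Suc k"] by linarith
      next
        case False
        have "scale k0 \<le> scale k0 powr s"
          using powr_mono'[of s 1 "scale k0"] scale[of k0] s by simp
        also have "\<dots> \<le> (v - u) powr s"
          using False s scale(1)[of k0] by (intro powr_mono2) auto
        finally have "1 \<le> 1 / scale k0 * (v - u) powr s"
          using scale(1)[of k0] by (simp add: field_simps)
        with m_le_1[of "Suc k" u v] show ?thesis
          by linarith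
      qed
      moreover have "C1 + 1 \<le> C" "1 / scale k0 \<le> C"
        using scale(1)[of k0] C1 by (simp_all add: C_def)
      then have "(C1 + 1) * (v - u) powr s \<le> C * (v - u) powr s"
        "1 / scale k0 * (v - u) powr s \<le> C * (v - u) powr s"
        by (intro mult_right_mono; simp)+
      ultimately show ?thesis
        by linarith
    qed
    have upper: "measure lborel (E k \<inter> {u..v}) \<le> C * P k * (v - u) powr s"
      if "Suc k0 \<le> k" "u < v" for k u v
    proof (cases k)
      case (Suc j)
      with that mC[of j u v] P[of k] show ?thesis
        by (simp add: m_def pos_divide_le_eq mult_ac)
    qed (use that in simp)
    show ?thesis
    proof (rule hausdorff_measure_neq_0[of E A P "1/4" C "Suc k0" s t])
      show "decseq E"
        by (rule decseq_SucI) (auto simp: ESuc)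
      show "(\<Inter>k. E k) \<subseteq> A"
        using A by (auto simp: E_def)
      show "0 < C"
        using C1 scale(1)[of k0] by (simp add: C_def add_pos_pos)
    qed (use E(1) P lower upper s in auto)
  qed
  then have "a \<le> t" if "0 \<le> t" "hausdorff_measure t A = 0" for t
    using that by force
  then show ?thesis
    unfolding hausdorff_dim_def a_def[symmetric] by (intro INF_greatest) auto
qed

section \<open>Waves\<close>

definition dist_int :: "real \<Rightarrow> real" where
  "dist_int y = \<bar>y - of_int (round y)\<bar>"

lemma dist_int_le: "dist_int y \<le> \<bar>y - of_int n\<bar>"
  unfolding dist_int_def by (rule round_diff_minimal)

lemma dist_int_nonneg: "0 \<le> dist_int y"
  by (simp add: dist_int_def)

lemma dist_int_le_half: "dist_int y \<le> 1 / 2"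
  using of_int_round_abs_le[of y] by (simp add: dist_int_def abs_minus_commute)

lemma dist_int_add_of_int: "dist_int (y + of_int n) = dist_int y"
proof (rule antisym)
  have "dist_int (y + of_int n) \<le> \<bar>(y + of_int n) - of_int (round y + n)\<bar>"
    by (rule dist_int_le)
  then show "dist_int (y + of_int n) \<le> dist_int y"
    by (simp add: dist_int_def)
  have "dist_int y \<le> \<bar>y - of_int (round (y + of_int n) - n)\<bar>"
    by (rule dist_int_le)
  then show "dist_int y \<le> dist_int (y + of_int n)"
    by (simp add: dist_int_def algebra_simps)
qed

lemma dist_int_lipschitz: "\<bar>dist_int y - dist_int z\<bar> \<le> \<bar>y - z\<bar>"
  using dist_int_le[of y "round z"] dist_int_le[of z "round y"] unfolding dist_int_def by linarith

lemma dist_int_eq_abs: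
  assumes "\<bar>y\<bar> \<le> 1 / 2"
  shows "dist_int y = \<bar>y\<bar>"
proof (rule antisym)
  show "dist_int y \<le> \<bar>y\<bar>"
    using dist_int_le[of y 0] by simp
  show "\<bar>y\<bar> \<le> dist_int y"
  proof (cases "round y = 0")
    case False
    then have "1 \<le> \<bar>real_of_int (round y)\<bar>"
      by linarith
    with assms show ?thesis
      unfolding dist_int_def by linarith
  qed (simp add: dist_int_def)
qed

lemma dist_int_unit_interval:
  assumes "0 \<le> y" "y \<le> 1"
  shows "dist_int y = min y (1 - y)"
proof (cases "y \<le> 1 / 2")
  case False
  have "dist_int y = dist_int (y - 1)"
    using dist_int_add_of_int[of y "- 1"] by simp
  with False assms show ?thesis
    by (simp add: dist_int_eq_abs)
qed (use assms in \<open>simp add: dist_int_eq_abs\<close>)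

text \<open>A nondecreasing function of \<open>u \<in> [0, 1/2]\<close> that climbs by \<open>A\<close> with slope \<open>L\<close> at \<open>0\<close>, on both
  sides of \<open>1/4\<close>, and at \<open>1/2\<close>.\<close>
definition staircase :: "real \<Rightarrow> real \<Rightarrow> real \<Rightarrow> real" where
  "staircase L A u = min A (L * u) + max (- A) (min A (L * (u - 1/4))) + max (- A) (L * (u - 1/2))"

text \<open>At each place one summand makes the whole climb (the first at \<open>0\<close>, the
  middle one at \<open>1/4\<close>, the last at \<open>1/2\<close>), and the other two are
  nondecreasing.\<close>

lemma staircase_increments:
  assumes "0 \<le> L" "0 \<le> A" "0 \<le> w"
  shows "min A (L * w) \<le> staircase L A w - staircase L A 0"
    and "min A (L * w) \<le> staircase L A (1/2) - staircase L A (1/2 - w)"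
    and "min A (L * w) \<le> staircase L A (1/4 + w) - staircase L A (1/4)"
    and "min A (L * w) \<le> staircase L A (1/4) - staircase L A (1/4 - w)"
proof -
  have "0 \<le> L * w"
    using assms by simp
  with assms show "min A (L * w) \<le> staircase L A w - staircase L A 0"
    "min A (L * w) \<le> staircase L A (1/2) - staircase L A (1/2 - w)"
    "min A (L * w) \<le> staircase L A (1/4 + w) - staircase L A (1/4)"
    "min A (L * w) \<le> staircase L A (1/4) - staircase L A (1/4 - w)"
    unfolding staircase_def right_diff_distrib distrib_left by (smt (verit))+
qed

lemma staircase_lipschitz:
  assumes "0 \<le> L"
  shows "\<bar>staircase L A u - staircase L A v\<bar> \<le> 3 * L * \<bar>u - v\<bar>"
proof -
  have "\<bar>L * u - L * v\<bar> = L * \<bar>u - v\<bar>"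
    using assms by (simp add: abs_mult flip: right_diff_distrib)
  moreover have "\<bar>staircase L A u - staircase L A v\<bar> \<le> 3 * \<bar>L * u - L * v\<bar>"
    unfolding staircase_def right_diff_distrib by (smt (verit))
  ultimately show ?thesis
    by simp
qed

text \<open>On this interval the three summands range within \<open>[0, A]\<close>,
  \<open>[-A, A]\<close> and \<open>[-A, 0]\<close>.\<close>

lemma staircase_osc:
  assumes "0 \<le> L" "0 \<le> A" "u \<in> {0..1/2}" "v \<in> {0..1/2}"
  shows "\<bar>staircase L A u - staircase L A v\<bar> \<le> 4 * A"
proof -
  have "0 \<le> L * u" "0 \<le> L * v" "L * (u - 1/2) \<le> 0" "L * (v - 1/2) \<le> 0"
    using assms by (auto simp: mult_nonneg_nonpos)
  with assms(2) show ?thesis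
    unfolding staircase_def by linarith
qed

definition wave :: "real \<Rightarrow> real \<Rightarrow> real \<Rightarrow> real" where
  "wave L A y = staircase L A (dist_int y)"

lemma wave_add_of_int: "wave L A (y + of_int n) = wave L A y"
  by (simp add: wave_def dist_int_add_of_int)

lemma wave_lipschitz:
  assumes "0 \<le> L"
  shows "\<bar>wave L A y - wave L A z\<bar> \<le> 3 * L * \<bar>y - z\<bar>"
proof -
  have "\<bar>wave L A y - wave L A z\<bar> \<le> 3 * L * \<bar>dist_int y - dist_int z\<bar>"
    unfolding wave_def by (rule staircase_lipschitz[OF assms])
  also have "\<dots> \<le> 3 * L * \<bar>y - z\<bar>"
    using assms dist_int_lipschitz by (intro mult_left_mono) auto
  finally show ?thesis .
qed

lemma continuous_on_wave:
  assumes "0 \<le> L"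
  shows "continuous_on S (wave L A)"
proof (rule continuous_on_subset[OF lipschitz_on_continuous_on])
  show "(3 * L)-lipschitz_on UNIV (wave L A)"
    using wave_lipschitz[OF assms] assms by (intro lipschitz_onI) (auto simp: dist_real_def)
qed simp

lemma wave_osc:
  assumes "0 \<le> L" "0 \<le> A"
  shows "\<bar>wave L A y - wave L A z\<bar> \<le> 4 * A"
  unfolding wave_def using assms dist_int_nonneg dist_int_le_half by (intro staircase_osc) auto

section \<open>Sign patterns and centres\<close>

definition sign_val :: "sign \<Rightarrow> real" where
  "sign_val s = (case s of Minus \<Rightarrow> - 1 | Plus \<Rightarrow> 1)"

text \<open>The first argument is the sign at \<open>- \<infinity>\<close>, the second the sign at \<open>+ \<infinity>\<close>.\<close>
fun centre :: "sign \<Rightarrow> sign \<Rightarrow> real" where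
  "centre Plus Plus = 0"
| "centre Minus Minus = 1 / 2"
| "centre Minus Plus = 1 / 4"
| "centre Plus Minus = 3 / 4"

text \<open>From a quarter point the distance moves monotonically for \<open>1/4\<close>, then turns
  at an integer or half-integer and comes back; the minimum records this.\<close>

lemma dist_int_near_centre:
  assumes "0 \<le> \<tau>" "\<tau> \<le> 1 / 2"
  shows "dist_int \<tau> = \<tau>" "dist_int (- \<tau>) = \<tau>"
    and "dist_int (1/2 + \<tau>) = 1/2 - \<tau>" "dist_int (1/2 - \<tau>) = 1/2 - \<tau>"
    and "dist_int (1/4 + \<tau>) = 1/4 + min \<tau> (1/2 - \<tau>)"
    and "dist_int (1/4 - \<tau>) = 1/4 - min \<tau> (1/2 - \<tau>)"
    and "dist_int (3/4 + \<tau>) = 1/4 - min \<tau> (1/2 - \<tau>)"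
    and "dist_int (3/4 - \<tau>) = 1/4 + min \<tau> (1/2 - \<tau>)"
proof -
  have "dist_int (3/4 + \<tau>) = dist_int (\<tau> - 1/4)"
    using dist_int_add_of_int[of "\<tau> - 1/4" 1] by (simp add: algebra_simps)
  with assms show "dist_int (3/4 + \<tau>) = 1/4 - min \<tau> (1/2 - \<tau>)"
    by (simp add: dist_int_eq_abs min_def)
qed (use assms in \<open>auto simp: dist_int_eq_abs dist_int_unit_interval min_def\<close>)

text \<open>At the extrema the displacement \<open>\<tau>\<close> itself works. The smaller
  \<open>min \<tau> (1/2 - \<tau>)\<close> gives one bound for all four centres, valid over half a
  turn.\<close>

lemma wave_from_centre:
  assumes L: "0 \<le> L" "0 \<le> A" and \<tau>: "0 \<le> \<tau>" "\<tau> \<le> 1 / 2"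
  shows "min A (L * min \<tau> (1/2 - \<tau>))
      \<le> sign_val t * (wave L A (centre s t + \<tau>) - wave L A (centre s t))"
    and "min A (L * min \<tau> (1/2 - \<tau>))
      \<le> sign_val s * (wave L A (centre s t - \<tau>) - wave L A (centre s t))"
proof -
  define w where "w = min \<tau> (1/2 - \<tau>)"
  have w: "0 \<le> w" "w \<le> \<tau>"
    using \<tau> by (auto simp: w_def)
  have "min A (L * w) \<le> min A (L * \<tau>)"
    using w L mult_left_mono[of w \<tau> L] by linarith
  note * = this staircase_increments(1,2)[OF L \<tau>(1)] staircase_increments(3,4)[OF L w(1)]
  have c: "dist_int 0 = 0" "dist_int (1/2) = 1/2" "dist_int (1/4) = 1/4" "dist_int (3/4) = 1/4"
    by (simp_all add: dist_int_unit_interval)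
  note near = dist_int_near_centre[OF \<tau>, folded w_def] c
  show "min A (L * min \<tau> (1/2 - \<tau>))
      \<le> sign_val t * (wave L A (centre s t + \<tau>) - wave L A (centre s t))"
    unfolding w_def[symmetric]
    using * by (cases s; cases t) (simp_all add: wave_def sign_val_def near)
  show "min A (L * min \<tau> (1/2 - \<tau>))
      \<le> sign_val s * (wave L A (centre s t - \<tau>) - wave L A (centre s t))"
    unfolding w_def[symmetric]
    using * by (cases s; cases t) (simp_all add: wave_def sign_val_def near)
qed

lemma filterlim_signed_infinity_iff:
  "filterlim f (signed_infinity s) F \<longleftrightarrow> filterlim (\<lambda>x. sign_val s * f x) at_top F"
  by (cases s) (simp_all add: sign_val_def filterlim_uminus_at_bot)

text \<open>The part of the shifted period beyond 1 is moved back by periodicity, so a coboundary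
  has zero mean.\<close>

lemma has_integral_diff_periodic_shift:
  fixes g :: "real \<Rightarrow> real"
  assumes cont: "continuous_on UNIV g" and per: "\<And>x. g (x + 1) = g x" and "0 \<le> a" "a \<le> 1"
  shows "((\<lambda>x. g (x + a) - g x) has_integral 0) {0..1}"
proof -
  have int: "g integrable_on {u..v}" for u v
    using cont by (intro integrable_continuous_interval) (auto intro: continuous_on_subset)
  have "integral {0..1} (\<lambda>x. g (x + a)) = integral {a..1 + a} g"
    using integral_shift_Icc_real[where a = 0 and b = 1 and c = a and f = g]
    by (simp add: o_def add.commute)
  also have "\<dots> = integral {a..1} g + integral {1..1 + a} g"
    using assms int by (intro Henstock_Kurzweil_Integration.integral_combine[symmetric]) auto
  also have "integral {1..1 + a} g = integral {0..a} (\<lambda>x. g (x + 1))"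
    using integral_shift_Icc_real[where a = 0 and b = a and c = 1 and f = g]
    by (simp add: o_def add.commute)
  also have "\<dots> = integral {0..a} g"
    by (simp add: per)
  also have "integral {a..1} g + integral {0..a} g = integral {0..1} g"
    using assms int Henstock_Kurzweil_Integration.integral_combine[of 0 a 1 g] by simp
  finally have eq: "integral {0..1} (\<lambda>x. g (x + a)) = integral {0..1} g" .
  have "(\<lambda>x. g (x + a)) integrable_on {0..1}"
    by (intro integrable_continuous_interval continuous_on_compose2[OF cont] continuous_intros) auto
  then show ?thesis
    using has_integral_diff[OF integrable_integral integrable_integral[OF int[of 0 1]],
        of "\<lambda>x. g (x + a)"] eq by simp
qed

section \<open>The cocycle\<close>

text \<open>For \<open>3 * 18^j \<le> n \<le> 3 * 18^(j+1)\<close> the term \<open>T j\<close> has reached its full height \<open>9^j\<close> and not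
  yet left it, earlier terms are small in comparison, and later ones still have the right sign.\<close>
lemma window_lower_bound:
  fixes T \<delta> :: "nat \<Rightarrow> real" and n J :: nat
  assumes "T sums S" and \<delta>: "\<And>k. 0 < \<delta> k" "\<And>k. 114 * 18 ^ k * \<delta> k \<le> 1"
    and n: "3 * 18 ^ J \<le> n"
    and T_ge: "\<And>k. - (4 * 9 ^ k) \<le> T k"
    and T_early: "\<And>k. real n * \<delta> k \<le> 1 / 2 \<Longrightarrow>
      min (9 ^ k) ((1/2) ^ k / (3 * \<delta> k) * min (real n * \<delta> k) (1/2 - real n * \<delta> k)) - 2 * (1/2) ^ k \<le> T k"
  shows "9 ^ J / 2 - 4 \<le> S"
proof -
  \<comment> \<open>The window containing \<open>n\<close>. Since \<open>J <= j\<close>, the bound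
    found there holds uniformly for all \<open>n\<close> beyond the start of window
    \<open>J\<close>.\<close>
  define j where "j = (LEAST j. n < 3 * 18 ^ Suc j)"
  have "n < 3 * 18 ^ Suc n"
    using power_gt_expt[of 18 "Suc n"] by simp
  then have upper: "n < 3 * 18 ^ Suc j"
    unfolding j_def by (rule LeastI)
  have "J \<le> j"
  proof (rule ccontr)
    assume "\<not> J \<le> j"
    then have "(18::nat) ^ Suc j \<le> 18 ^ J"
      by (intro power_increasing) auto
    with upper n show False
      by linarith
  qed
  have lower: "3 * 18 ^ j \<le> n"
  proof (cases j)
    case 0
    with \<open>J \<le> j\<close> n show ?thesis
      by simp
  next
    case (Suc i)
    then have "i < (LEAST j. n < 3 * 18 ^ Suc j)"
      unfolding j_def by simp
    then have "\<not> n < 3 * 18 ^ Suc i"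
      by (rule not_less_Least)
    with Suc show ?thesis
      by simp
  qed
  have "real n \<le> real (3 * 18 ^ Suc j)" "real (3 * 18 ^ j) \<le> real n"
    unfolding of_nat_le_iff using upper lower by (simp_all only: less_imp_le)
  then have upper': "real n \<le> 3 * 18 ^ Suc j" and lower': "3 * 18 ^ j \<le> real n"
    by (simp_all only: of_nat_mult of_nat_power of_nat_numeral)
  \<comment> \<open>A termwise minorant up to the summable loss: earlier terms at their worst, the
    current one at full height, later ones at 0.\<close>
  define f :: "nat \<Rightarrow> real" where "f k = (if k < j then - (4 * 9 ^ k) else if k = j then 9 ^ j else 0)" for k
  have f_le: "f k - 2 * (1/2) ^ k \<le> T k" for k
  proof (cases "k < j")
    case True
    have "(0::real) \<le> (1/2) ^ k"
      by simp
    with True T_ge[of k] show ?thesis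
      by (simp only: f_def if_True)
  next
    case False
    \<comment> \<open>Here \<open>3 * 18^(k+1) + 3 * 18^k = 57 * 18^k\<close>, and twice 57 is the
      constant 114.\<close>
    have scale: "real n * \<delta> k \<le> 1/2 - 3 * 18 ^ k * \<delta> k"
    proof -
      have "(18::real) ^ Suc j \<le> 18 ^ Suc k"
        using False by (intro power_increasing) auto
      then have "real n \<le> 3 * 18 ^ Suc k"
        using upper' by linarith
      then have "real n * \<delta> k \<le> 3 * 18 ^ Suc k * \<delta> k"
        using \<delta>(1)[of k] by (intro mult_right_mono) auto
      with \<delta>(2)[of k] show ?thesis
        by simp
    qed
    moreover have "0 \<le> 3 * 18 ^ k * \<delta> k"
      using \<delta>(1)[of k] by simp
    ultimately have half: "real n * \<delta> k \<le> 1/2"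
      by linarith
    have "f k \<le> min (9 ^ k) ((1/2) ^ k / (3 * \<delta> k) * min (real n * \<delta> k) (1/2 - real n * \<delta> k))"
    proof (cases "k = j")
      case True
      have "3 * 18 ^ k * \<delta> k \<le> real n * \<delta> k"
        using lower' True \<delta>(1)[of k] by (intro mult_right_mono) auto
      with scale have "3 * 18 ^ k * \<delta> k \<le> min (real n * \<delta> k) (1/2 - real n * \<delta> k)"
        by simp
      then have "(1/2) ^ k / (3 * \<delta> k) * (3 * 18 ^ k * \<delta> k)
          \<le> (1/2) ^ k / (3 * \<delta> k) * min (real n * \<delta> k) (1/2 - real n * \<delta> k)"
        using \<delta>(1)[of k] by (intro mult_left_mono) auto
      \<comment> \<open>The base 18 is \<open>2 * 9\<close>: one factor offsets the decay
        \<open>(1/2)^k\<close> of the slope, the other produces the height.\<close>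
      moreover have "(1/2) ^ k / (3 * \<delta> k) * (3 * 18 ^ k * \<delta> k) = 9 ^ k"
        using \<delta>(1)[of k] by (simp add: field_simps flip: power_mult_distrib)
      ultimately show ?thesis
        using True by (simp add: f_def)
    next
      case False
      have "0 \<le> (1/2) ^ k / (3 * \<delta> k) * min (real n * \<delta> k) (1/2 - real n * \<delta> k)"
        using half \<delta>(1)[of k] by (intro mult_nonneg_nonneg) auto
      then show ?thesis
        using False \<open>\<not> k < j\<close> by (simp add: f_def)
    qed
    with T_early[OF half] show ?thesis
      by linarith
  qed
  have f_sums: "(\<lambda>k. f k - 2 * (1/2) ^ k) sums (sum f {..j} - 2 * 2)"
  proof (rule sums_diff)
    show "f sums sum f {..j}"
      by (intro sums_finite) (auto simp: f_def)
    show "(\<lambda>k. 2 * (1/2) ^ k) sums (2 * 2 :: real)"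
    proof (rule sums_mult)
      have "norm (1/2 :: real) < 1" "1 / (1 - 1/2) = (2 :: real)"
        by simp_all
      with geometric_sums[of "1/2 :: real"] show "(\<lambda>k. (1/2) ^ k) sums (2 :: real)"
        by metis
    qed
  qed
  have "sum f {..j} - 2 * 2 \<le> S"
    by (rule sums_le[OF f_le f_sums \<open>T sums S\<close>])
  moreover have "9 ^ j / 2 \<le> sum f {..j}"
  proof -
    have "sum f {..j} = (\<Sum>k<j. - (4 * 9 ^ k)) + 9 ^ j"
      unfolding lessThan_Suc_atMost[symmetric] sum.lessThan_Suc by (simp add: f_def)
    \<comment> \<open>Growth by the factor 9 keeps the total oscillation \<open>4 * 9^k\<close> of
      all earlier terms below half of the current height.\<close>
    also have "(\<Sum>k<j. - (4 * 9 ^ k :: real)) = - ((9 ^ j - 1) / 2)"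
      by (induction j) (simp_all add: field_simps)
    finally show ?thesis
      by simp
  qed
  moreover have "(9::real) ^ J \<le> 9 ^ j"
    using \<open>J \<le> j\<close> by (intro power_increasing) auto
  ultimately show ?thesis
    by linarith
qed

lemma filterlim_at_top_of_window_bound:
  fixes F :: "int \<Rightarrow> real"
  assumes "\<And>n J. 3 * 18 ^ J \<le> n \<Longrightarrow> 9 ^ J / 2 - 4 \<le> F (int n)"
  shows "filterlim F at_top at_top"
  unfolding filterlim_at_top eventually_at_top_linorder
proof (intro allI)
  fix Z :: real
  obtain J where J: "2 * (Z + 4) < 9 ^ J"
    using real_arch_pow[of 9 "2 * (Z + 4)"] by auto
  have "Z \<le> F m" if "int (3 * 18 ^ J) \<le> m" for m
  proof -
    have "9 ^ J / 2 - 4 \<le> F (int (nat m))"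
      using that by (intro assms) linarith
    moreover have "int (nat m) = m"
      using that by (metis int_nat_eq of_nat_0_le_iff order_trans)
    ultimately show ?thesis
      using J by simp
  qed
  then show "\<exists>N. \<forall>m\<ge>N. Z \<le> F m"
    by blast
qed

section \<open>Coboundary series over slow rotations\<close>

locale slow_rotations =
  fixes \<alpha> :: real and Q p :: "nat \<Rightarrow> int" and \<delta> :: "nat \<Rightarrow> real"
  assumes \<delta>_eq: "\<And>k. \<delta> k = of_int (Q k) * \<alpha> - of_int (p k)"
    and \<delta>_pos: "\<And>k. 0 < \<delta> k"
    and \<delta>_small: "\<And>k. 114 * 18 ^ k * \<delta> k \<le> 1"
    and \<alpha>: "0 \<le> \<alpha>" "\<alpha> \<le> 1"
begin

text \<open>With the Lipschitz constant \<open>3 * slope k\<close> of the wave, a displacement by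
  \<open>\<delta> k\<close> costs at most \<open>(1/2)^k\<close>.\<close>

definition slope :: "nat \<Rightarrow> real" where
  "slope k = (1/2) ^ k / (3 * \<delta> k)"

definition transfer :: "nat \<Rightarrow> real \<Rightarrow> real" where
  "transfer k x = wave (slope k) (9 ^ k) (of_int (Q k) * x)"

text \<open>Only increments are summed: they are at most \<open>(1/2)^k\<close>, while the growing
  heights \<open>9^k\<close> of the transfer functions let the Birkhoff sums diverge.\<close>

definition cocycle :: "real \<Rightarrow> real" where
  "cocycle x = (\<Sum>k. transfer k (x + \<alpha>) - transfer k x)"

lemma \<delta>_le: "\<delta> k \<le> 1 / 8"
proof -
  have "(8::real) \<le> 114 * 18 ^ k"
    using one_le_power[of "18::real" k] by linarith
  then have "8 * \<delta> k \<le> 114 * 18 ^ k * \<delta> k"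
    using \<delta>_pos[of k] by (intro mult_right_mono) auto
  with \<delta>_small[of k] show ?thesis
    by linarith
qed

lemma slope_nonneg: "0 \<le> slope k"
  using \<delta>_pos[of k] by (simp add: slope_def)

lemma slope_\<delta>: "3 * slope k * \<delta> k = (1/2) ^ k"
  using \<delta>_pos[of k] by (simp add: slope_def)

text \<open>Modulo the integer \<open>p k\<close>, the number \<open>Q k * \<alpha>\<close> is
  \<open>\<delta> k\<close>, so the rotation seen through frequency \<open>Q k\<close> is
  slow.\<close>

lemma transfer_shift:
  "transfer k (x + of_int m * \<alpha>) = wave (slope k) (9 ^ k) (of_int (Q k) * x + of_int m * \<delta> k)"
proof -
  have "of_int (Q k) * (x + of_int m * \<alpha>) = of_int (Q k) * x + of_int m * \<delta> k + of_int (m * p k)"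
    by (simp add: \<delta>_eq algebra_simps)
  then show ?thesis
    unfolding transfer_def by (simp only: wave_add_of_int)
qed

lemma transfer_increment: "\<bar>transfer k (x + \<alpha>) - transfer k x\<bar> \<le> (1/2) ^ k"
proof -
  have "\<bar>transfer k (x + \<alpha>) - transfer k x\<bar> \<le> 3 * slope k * \<bar>\<delta> k\<bar>"
    using transfer_shift[of k x 1]
      wave_lipschitz[OF slope_nonneg, of k "9 ^ k" "of_int (Q k) * x + \<delta> k" "of_int (Q k) * x"]
    by (simp add: transfer_def)
  then show ?thesis
    using \<delta>_pos[of k] slope_\<delta>[of k] by simp
qed

lemma continuous_on_transfer: "continuous_on S (transfer k)"
  unfolding transfer_def
  by (intro continuous_on_compose2[OF continuous_on_wave[OF slope_nonneg]] continuous_intros) auto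

lemma transfer_periodic: "transfer k (x + 1) = transfer k x"
  using wave_add_of_int[of "slope k" "9 ^ k" "of_int (Q k) * x" "Q k"]
  by (simp add: transfer_def algebra_simps)

lemma uniform_limit_cocycle:
  "uniform_limit S (\<lambda>n x. \<Sum>k<n. transfer k (x + \<alpha>) - transfer k x) cocycle sequentially"
  unfolding cocycle_def[abs_def] using transfer_increment
  by (intro Weierstrass_m_test[where M = "\<lambda>k. (1/2) ^ k"]) (auto simp: summable_geometric)

lemma cocycle_sums: "(\<lambda>k. transfer k (x + \<alpha>) - transfer k x) sums cocycle x"
  using tendsto_uniform_limitI[OF uniform_limit_cocycle[of UNIV], of x] by (simp add: sums_def)

lemma continuous_on_partial_sum: "continuous_on S (\<lambda>x. \<Sum>k<n. transfer k (x + \<alpha>) - transfer k x)"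
  by (intro continuous_intros continuous_on_compose2[OF continuous_on_transfer[of UNIV]]) auto

lemma continuous_on_circle_cocycle: "continuous_on_circle cocycle"
proof -
  have "continuous_on UNIV cocycle"
    using uniform_limit_theorem[OF _ uniform_limit_cocycle] continuous_on_partial_sum by simp
  moreover have "transfer k (x + 1 + \<alpha>) = transfer k (x + \<alpha>)" for k x
    using transfer_periodic[of k "x + \<alpha>"] by (simp add: add_ac)
  then have "cocycle (x + 1) = cocycle x" for x
    by (simp add: cocycle_def transfer_periodic)
  ultimately show ?thesis
    by (simp add: continuous_on_circle_def)
qed

lemma integral_cocycle: "integral {0..1} cocycle = 0"
proof -
  obtain I J where I: "\<And>n. ((\<lambda>x. \<Sum>k<n. transfer k (x + \<alpha>) - transfer k x) has_integral I n) {0..1}"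
    and J: "(cocycle has_integral J) {0..1}" and lim: "I \<longlonglongrightarrow> J"
    by (rule uniform_limit_integral[OF uniform_limit_cocycle[of "{0..1}"]
          continuous_on_partial_sum sequentially_bot]) (rule that)
  have "((\<lambda>x. \<Sum>k<n. transfer k (x + \<alpha>) - transfer k x) has_integral (\<Sum>k<n. 0)) {0..1}" for n
    using \<alpha> continuous_on_transfer transfer_periodic
    by (intro has_integral_sum has_integral_diff_periodic_shift) auto
  then have "I = (\<lambda>n. 0)"
    using has_integral_unique[OF I] by fastforce
  with lim have "J = 0"
    by (simp add: LIMSEQ_const_iff)
  with J show ?thesis
    by (simp add: integral_unique)
qed

text \<open>Every coboundary telescopes along the orbit in either direction, leaving only the two
  end points.\<close>

lemma birkhoff_sum_sums:
  "(\<lambda>k. transfer k (x + of_int m * \<alpha>) - transfer k x) sums birkhoff_sum \<alpha> cocycle m x"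
proof (cases m rule: int_cases2)
  case (nonneg n)
  have "(\<lambda>k. transfer k (x + real n * \<alpha>) - transfer k x) sums (\<Sum>i<n. cocycle (x + real i * \<alpha>))"
  proof (induction n)
    case (Suc n)
    from sums_add[OF Suc cocycle_sums[of "x + real n * \<alpha>"]] show ?case
      by (simp add: algebra_simps)
  qed simp
  then show ?thesis
    by (simp add: nonneg birkhoff_sum_def)
next
  case (nonpos n)
  have "(\<lambda>k. transfer k (x - real n * \<alpha>) - transfer k x) sums - (\<Sum>i=1..n. cocycle (x - real i * \<alpha>))"
  proof (induction n)
    case (Suc n)
    from sums_diff[OF Suc cocycle_sums[of "x - real (Suc n) * \<alpha>"]] show ?case
      by (simp add: algebra_simps minus_diff_commute)
  qed simp
  then show ?thesis
    by (cases "n = 0") (simp_all add: nonpos birkhoff_sum_def)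
qed

text \<open>Replacing \<open>Q k * x\<close> by the nearby centre costs at most \<open>2 * (1/2)^k\<close>; the two signs of \<open>e\<close>
  treat forward and backward Birkhoff sums at once.\<close>
lemma birkhoff_sum_window:
  assumes x: "\<And>k. x \<in> comb (of_int (Q k)) c (\<delta> k)" and e: "\<bar>e\<bar> = 1" and r: "\<bar>r\<bar> = 1"
    and wave_c: "\<And>L A \<tau>. 0 \<le> L \<Longrightarrow> 0 \<le> A \<Longrightarrow> 0 \<le> \<tau> \<Longrightarrow> \<tau> \<le> 1/2 \<Longrightarrow>
      min A (L * min \<tau> (1/2 - \<tau>)) \<le> r * (wave L A (c + of_int e * \<tau>) - wave L A c)"
    and n: "3 * 18 ^ J \<le> n"
  shows "9 ^ J / 2 - 4 \<le> r * birkhoff_sum \<alpha> cocycle (e * int n) x"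
proof (rule window_lower_bound[OF sums_mult[OF birkhoff_sum_sums] \<delta>_pos \<delta>_small n])
  fix k
  define y where "y = of_int (Q k) * x"
  have T: "transfer k (x + of_int (e * int n) * \<alpha>) - transfer k x =
      wave (slope k) (9 ^ k) (y + of_int e * (real n * \<delta> k)) - wave (slope k) (9 ^ k) y"
    unfolding transfer_shift by (simp add: transfer_def y_def mult_ac)
  have r_ge: "- \<bar>w\<bar> \<le> r * w" for w
    using r by (cases "0 \<le> r") auto
  show "- (4 * 9 ^ k) \<le> r * (transfer k (x + of_int (e * int n) * \<alpha>) - transfer k x)"
    unfolding T
    using wave_osc[OF slope_nonneg, of "9 ^ k" k "y + of_int e * (real n * \<delta> k)" y] r_ge
    by (smt (verit) zero_le_power)
  assume half: "real n * \<delta> k \<le> 1/2"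
  let ?W = "wave (slope k) (9 ^ k)"
  let ?\<tau> = "of_int e * (real n * \<delta> k)"
  have "\<delta> k < 1"
    using \<delta>_le[of k] by simp
  then obtain N :: int where N: "of_int N \<le> y - c" "y - c \<le> of_int N + \<delta> k"
    using x[of k] frac_le_iff[of "\<delta> k" "y - c"] \<delta>_pos[of k] by (auto simp: comb_def y_def)
  \<comment> \<open>Stated for every \<open>v\<close> because it is applied at both ends of the
    orbit segment; periodicity absorbs \<open>N\<close>.\<close>
  have close: "\<bar>?W (y + v) - ?W (c + v)\<bar> \<le> (1/2) ^ k" for v
  proof -
    have "?W (c + v) = ?W (c + v + of_int N)"
      by (simp only: wave_add_of_int)
    then have "\<bar>?W (y + v) - ?W (c + v)\<bar> \<le> 3 * slope k * \<bar>(y + v) - (c + v + of_int N)\<bar>"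
      by (simp only: wave_lipschitz[OF slope_nonneg])
    also have "\<dots> \<le> 3 * slope k * \<delta> k"
      using N slope_nonneg by (intro mult_left_mono) auto
    finally show ?thesis
      unfolding slope_\<delta> .
  qed
  have "min (9 ^ k) (slope k * min (real n * \<delta> k) (1/2 - real n * \<delta> k)) \<le> r * (?W (c + ?\<tau>) - ?W c)"
    using half \<delta>_pos[of k] slope_nonneg by (intro wave_c) auto
  moreover have "r * (?W (y + ?\<tau>) - ?W y) =
      r * (?W (c + ?\<tau>) - ?W c) + r * (?W (y + ?\<tau>) - ?W (c + ?\<tau>)) + r * (?W c - ?W y)"
    by (simp add: algebra_simps)
  moreover have "- ((1/2) ^ k) \<le> r * (?W (y + ?\<tau>) - ?W (c + ?\<tau>))"
    using close[of ?\<tau>] r_ge[of "?W (y + ?\<tau>) - ?W (c + ?\<tau>)"] by linarith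
  moreover have "- ((1/2) ^ k) \<le> r * (?W c - ?W y)"
    using close[of 0] r_ge[of "?W c - ?W y"] by simp
  ultimately show "min (9 ^ k) ((1/2) ^ k / (3 * \<delta> k) * min (real n * \<delta> k) (1/2 - real n * \<delta> k))
      - 2 * (1/2) ^ k \<le> r * (transfer k (x + of_int (e * int n) * \<alpha>) - transfer k x)"
    unfolding T slope_def[symmetric] by linarith
qed

text \<open>Multiplying by \<open>sign_val\<close> turns every required limit into divergence to
  plus infinity, and negating \<open>m\<close> turns backward time into forward time.\<close>

lemma comb_Int_subset_discrete_orbit_set:
  "{0..1/2} \<inter> (\<Inter>k. comb (of_int (Q k)) (centre s t) (\<delta> k)) \<subseteq> discrete_orbit_set s t \<alpha> cocycle"
proof
  fix x
  assume "x \<in> {0..1/2} \<inter> (\<Inter>k. comb (of_int (Q k)) (centre s t) (\<delta> k))"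
  then have x: "x \<in> {0..<1}" "\<And>k. x \<in> comb (of_int (Q k)) (centre s t) (\<delta> k)"
    by auto
  have sign: "\<bar>sign_val s\<bar> = 1" for s
    by (cases s) (simp_all add: sign_val_def)
  have forward: "filterlim (\<lambda>m. sign_val t * birkhoff_sum \<alpha> cocycle m x) at_top at_top"
    using birkhoff_sum_window[OF x(2), of 1 "sign_val t"] sign wave_from_centre(1)
    by (intro filterlim_at_top_of_window_bound) simp
  have backward: "filterlim (\<lambda>m. sign_val s * birkhoff_sum \<alpha> cocycle (- m) x) at_top at_top"
    using birkhoff_sum_window[OF x(2), of "- 1" "sign_val s"] sign wave_from_centre(2)
    by (intro filterlim_at_top_of_window_bound) simp
  have "filterlim (uminus :: int \<Rightarrow> int) at_top at_bot"
    unfolding filterlim_at_top eventually_at_bot_linorder 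
    by (metis le_minus_iff)
  from filterlim_compose[OF backward this]
  have "filterlim (\<lambda>m. sign_val s * birkhoff_sum \<alpha> cocycle m x) at_top at_bot"
    by simp
  with forward show "x \<in> discrete_orbit_set s t \<alpha> cocycle"
    using x(1) unfolding discrete_orbit_set_def filterlim_signed_infinity_iff by simp
qed

end

section \<open>Choice of the approximations and conclusion\<close>

theorem theorem8:
  fixes \<alpha> \<gamma> C :: real
  assumes "\<alpha> \<in> {0..<1}" and "\<alpha> \<notin> \<rat>"
    and "\<gamma> \<ge> 1" and "C > 0"
    and "infinite {n. real_of_int (cf_denom \<alpha> (n + 1)) \<le> C * real_of_int (cf_denom \<alpha> n) powr \<gamma>}"
  shows "\<exists>\<phi>. continuous_on_circle \<phi> \<and> integral {0..1} \<phi> = 0 \<and>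
           (\<forall>s t. hausdorff_dim (discrete_orbit_set s t \<alpha> \<phi>) \<ge> ereal (1 / (1 + \<gamma>)))"
proof -
  define d where "d z = of_int (fst z) * \<alpha> - of_int (snd z)" for z :: "int \<times> int"
  \<comment> \<open>The first summand enforces the smallness of \<open>\<delta> k\<close>, the
    second the sparsity condition of the dimension estimate, with \<open>16 = 2 * 8\<close>.\<close>
  define R where "R z k = 114 * 18 ^ k +
      16 * (\<Prod>i<k. \<bar>of_int (fst (z i))\<bar> + 2) / (\<Prod>i<k. d (z i)) ^ (k + 2)"
    for z :: "nat \<Rightarrow> int \<times> int" and k
  define good where "good z k w \<longleftrightarrow> R z k \<le> \<bar>of_int (fst w)\<bar> \<and> 0 < d w \<and> d w \<le> 1 / R z k \<and>
      1 / (2 * C) * \<bar>of_int (fst w)\<bar> powr (- \<gamma>) \<le> d w" for z k w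
  have "\<exists>z. \<forall>k. good z k (z k)"
  \<comment> \<open>\<open>R z k\<close> depends only on the pairs chosen before \<open>k\<close>,
    so the pairs can be chosen recursively.\<close>
  proof (rule dependent_wellorder_choice)
    fix w k and z z' :: "nat \<Rightarrow> int \<times> int"
    assume "\<And>i. i < k \<Longrightarrow> z i = z' i"
    then have "R z k = R z' k"
      by (simp add: R_def)
    then show "good z k w = good z' k w"
      by (simp add: good_def)
  next
    fix k and z :: "nat \<Rightarrow> int \<times> int"
    assume "\<And>i. i < k \<Longrightarrow> good z i (z i)"
    then have "0 < (\<Prod>i<k. d (z i))"
      by (intro prod_pos) (auto simp: good_def)
    moreover have "0 < (\<Prod>i<k. \<bar>real_of_int (fst (z i))\<bar> + 2)"
      by (intro prod_pos) (auto intro: add_nonneg_pos)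
    ultimately have "0 < R z k"
      unfolding R_def by (intro add_pos_pos divide_pos_pos mult_pos_pos) auto
    from ex_approximation_above[OF assms(1,2,4,5) this]
    show "\<exists>w. good z k w"
      by (auto simp: d_def good_def)
  qed
  then obtain z where "\<And>k. good z k (z k)"
    by blast
  then have z: "R z k \<le> \<bar>of_int (fst (z k))\<bar>" "0 < d (z k)" "d (z k) \<le> 1 / R z k"
    "1 / (2 * C) * \<bar>of_int (fst (z k))\<bar> powr (- \<gamma>) \<le> d (z k)" for k
    unfolding good_def by blast+
  define Q where "Q k = fst (z k)" for k
  define \<delta> where "\<delta> k = d (z k)" for k
  have P: "0 < (\<Prod>i<k. \<delta> i)" for k
    unfolding \<delta>_def using z(2) by (intro prod_pos) auto
  have "0 < (\<Prod>i<k. \<bar>real_of_int (Q i)\<bar> + 2)" for k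
    by (intro prod_pos) (auto intro: add_nonneg_pos)
  then have "0 < 16 * (\<Prod>i<k. \<bar>of_int (Q i)\<bar> + 2) / (\<Prod>i<k. \<delta> i) ^ (k + 2)" for k
    using P by (intro divide_pos_pos mult_pos_pos) auto
  then have R: "114 * 18 ^ k < R z k" "16 * (\<Prod>i<k. \<bar>of_int (Q i)\<bar> + 2) / (\<Prod>i<k. \<delta> i) ^ (k + 2) < R z k" for k
    unfolding R_def Q_def \<delta>_def by (simp_all add: add_strict_increasing)
  have R_pos: "0 < R z k" for k
    using R(1)[of k] by (meson less_trans zero_less_mult_iff zero_less_numeral zero_less_power)
  have small: "114 * 18 ^ k * \<delta> k \<le> 1" for k
  proof -
    have "114 * 18 ^ k * \<delta> k \<le> R z k * \<delta> k"
      using R(1)[of k] z(2)[of k] by (intro mult_right_mono) (auto simp: \<delta>_def)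
    also have "\<dots> \<le> 1"
      using z(3)[of k] R_pos[of k] by (simp add: \<delta>_def field_simps)
    finally show ?thesis .
  qed
  interpret slow_rotations \<alpha> Q "\<lambda>k. snd (z k)" \<delta>
    using small z(2) assms(1) by unfold_locales (auto simp: \<delta>_def Q_def d_def)
  have "ereal (1 / (1 + \<gamma>)) \<le> hausdorff_dim (discrete_orbit_set s t \<alpha> cocycle)" for s t
  proof (rule hausdorff_dim_comb_Int_ge[where Q = "\<lambda>k. \<bar>of_int (Q k)\<bar>" and \<rho> = \<delta> and \<kappa> = "1 / (2 * C)"
        and c = "\<lambda>k. if 0 < Q k then centre s t else - centre s t - \<delta> k"])
    \<comment> \<open>The dimension estimate needs positive frequencies: a negative
      \<open>Q k\<close> is replaced by its absolute value, with the offset reflected.\<close>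
    have comb_eq: "comb \<bar>of_int (Q k)\<bar> (if 0 < Q k then centre s t else - centre s t - \<delta> k) (\<delta> k) =
        comb (of_int (Q k)) (centre s t) (\<delta> k)" for k
    proof (cases "0 < Q k")
      case False
      then show ?thesis
        using comb_uminus[of "\<delta> k" "- of_int (Q k)" "centre s t"] \<delta>_pos[of k] \<delta>_le[of k] by simp
    qed simp
    show "{0..1/2} \<inter> (\<Inter>k. comb \<bar>of_int (Q k)\<bar> (if 0 < Q k then centre s t else - centre s t - \<delta> k) (\<delta> k))
        \<subseteq> discrete_orbit_set s t \<alpha> cocycle"
      unfolding comb_eq by (rule comb_Int_subset_discrete_orbit_set)
    fix k
    show Q_pos: "0 < \<bar>real_of_int (Q k)\<bar>"
      using z(1)[of k] R_pos[of k] unfolding Q_def by linarith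
    have "16 * (\<Prod>i<k. \<bar>of_int (Q i)\<bar> + 2) / (\<Prod>i<k. \<delta> i) ^ (k + 2) \<le> \<bar>of_int (Q k)\<bar>"
      using R(2)[of k] z(1)[of k] unfolding Q_def by linarith
    then show "2 * (\<Prod>i<k. \<bar>of_int (Q i)\<bar> + 2) \<le> \<bar>of_int (Q k)\<bar> * (\<Prod>i<k. \<delta> i) ^ (k + 2) / 8"
      using zero_less_power[OF P, of k "k + 2"] by (simp add: pos_divide_le_eq)
  qed (use assms z(4) \<delta>_pos \<delta>_le in \<open>auto simp: Q_def \<delta>_def\<close>)
  then show ?thesis
    using continuous_on_circle_cocycle integral_cocycle by blast
qed

end
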